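(* Let $R$ be a rule on the domain $\mathcal{D}$ of museum pass problems with consortia. Then $R$ satisfies composition, dummy, symmetry within consortia, splitting-proofness of consortia and consortia consistency if and only if $R$ is the proportional-egalitarian rule $R^{PE}$, where for each $D=(M,P,N,\pi,C)\in\mathcal{D}$ and each $i\in M$, $$R^{PE}_{i}(D)=\sum_{a \in N^0_i} \frac{1}{|M_a \cap P^{(i)}|}\, \frac{\pi^{(i)}}{\sum_{t \in K^0_a}\pi^t}\, \pi^0+\sum_{a \in N^{(i)}_i} \frac{1}{|M_a|}\,\pi^{(i)}+|N^{-i}|\,\pi^{-i}.$$
   Context: **Problems.** Fix an infinite set $\mathbb{M}$ of potential museums containing the positive integers, and an infinite set $\mathbb{N}$ of potential pass holders. A museum pass problem with consortia (a *problem* ) is a 5-tuple $D=(M,P,N,\pi,C)$ where: - $M$ is a finite non-empty subset of $\mathbb{M}$ (the museums), $m=|M|$. - $P=\{P_1,\dots,P_s\}$ is a partition of $M$ into non-empty sets (the consortia). The enumeration is only a notational device; data carrying superscript $t$ are attached to the consortium $P_t$. - $N$ is a family of pairwise disjoint finite subsets of $\mathbb{N}$ (each possibly empty): $N^{-i}$ for each $i\in M$ (holders of the individual pass of museum $i$), $N^0$ (holders of the general pass), and $N^t$ for each consortium $P_t$ (holders of the pass of consortium $P_t$). If $P_t=\{i\}$ is a singleton, then $N^{-i}=\varnothing$. - $\pi$ is a family of strictly positive real prices $\pi^{-i}$ ($i\in M$), $\pi^0$, $\pi^t$ ($P_t\in P$). If $P_t=\{i\}$, then $\pi^{-i}=\pi^t$.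 - $C$ is a family of $0/1$ matrices: $C^{-i}$ with the single row $i$ and columns $N^{-i}$; $C^0$ with rows $M$ and columns $N^0$; $C^t$ with rows $P_t$ and columns $N^t$. An entry indexed by $(i,a)$ is $1$ iff holder $a$ visits museum $i$. Every column of every matrix contains at least one $1$ (every holder visits at least one museum). A matrix with no columns is written $\varnothing$. $\mathcal{D}$ is the set of all problems; $\mathcal{D}^0\subset\mathcal{D}$ is the set of problems in which all the holder sets other than $N^0$ are empty. **Notation.** $P^{(i)}$ is the unique consortium containing $i$, and $N^{(i)},\pi^{(i)},C^{(i)}$ are the set of holders, price and matrix attached to that consortium. For each pass index $\sigma$ (i.e. $\sigma=-j$ with $j \in M$, $\sigma=0$, or $\sigma=t$ a consortium), $N^\sigma_i=\{a\in N^\sigma: C^\sigma_{ia}=1\}$. $M_a$ is the set of museums visited by holder $a$. For $a\in N^0$, $K^0_a=\{k: C^0_{ia}=1\text{ for some } i\in P_k\}$. **Rules.** The total revenue is $E=\sum_{i\in M}|N^{-i}|\pi^{-i}+|N^0|\pi^0+\sum_{t=1}^s|N^t|\pi^t$. A *rule* is a map $R$ assigning to each $D\in\mathcal{D}$ a vector $R(D)\in\mathbb{R}_+^M$ with $\sum_{i\in M}R_i(D)=E$. **Axioms.** - *Composition*: for all $(M,P,N_1,\pi,C_1),(M,P,N_2,\pi,C_2)\in\mathcal{D}$ such that no pass holder occurs in both $N_1$ and $N_2$, $R(M,P,N_1\cup N_2,\pi,(C_1,C_2))=R(M,P,N_1,\pi,C_1)+R(M,P,N_2,\pi,C_2)$,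 where $N_1\cup N_2$ is the componentwise union and $(C_1,C_2)$ is the componentwise concatenation of columns. - *Dummy*: for each $D\in\mathcal{D}$ and $i\in M$, if for each $\sigma\in\{-i,0,(i)\}$ either $C^\sigma=\varnothing$ or $C^\sigma_{ia}=0$ for all $a\in N^\sigma$, then $R_i(D)=0$. - *Symmetry within consortia*: for each $D\in\mathcal{D}$ and $i,j\in M$ with $P^{(i)}=P^{(j)}$, if (i) $C^0_{ia}=C^0_{ja}$ for all $a\in N^0$, (ii) $C^{(i)}_{ia}=C^{(j)}_{ja}$ for all $a\in N^{(i)}=N^{(j)}$, and (iii) $\pi^{-i}|N^{-i}|=\pi^{-j}|N^{-j}|$, then $R_i(D)=R_j(D)$. - *Splitting-proofness of consortia*: let $D=(M,P,N,\pi,C)\in\mathcal{D}$ and $P_k=\{i_1,\dots,i_r\}\in P$, and let $D'=(M',P',N',\pi',C')\in\mathcal{D}$ be obtained by splitting $P_k$ into consortia $P_{k_l}=\{i^l_1,\dots,i^l_r\}$, $l=1,\dots,t$, where the $i^l_h$ are distinct elements of $\mathbb{M}\setminus(M\setminus P_k)$: $M'=(M\setminus P_k)\cup\bigcup_{l=1}^tP_{k_l}$; $P'=(P\setminus\{P_k\})\cup\{P_{k_1},\dots,P_{k_t}\}$; each $N^{k_l}$ is a (disjoint) copy of $N^k$ and each $N^{-i^l_h}$ is a (disjoint) copy of $N^{-i_h}$; the new prices are positive with $\sum_{l=1}^t\pi^{k_l}=\pi^k$ and $\sum_{l=1}^t\pi^{-i^l_h}=\pi^{-i_h}$ for every $h\in\{1,\dots,r\}$;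 $C'^0_{i^l_ha}=C^0_{i_ha}$ for all $a\in N^0$ and all $l,h$; each $C^{k_l}$ is a copy of $C^k$ (row $i^l_h$ corresponding to row $i_h$) and each $C^{-i^l_h}$ is a copy of $C^{-i_h}$; all other data are unchanged. Then $\sum_{j\in P_q}R_j(D)=\sum_{j\in P_q}R_j(D')$ for each $P_q\in P\setminus\{P_k\}$. - *Consortia consistency*: for each $D=(M,P,N,\pi,C)\in\mathcal{D}^0$ with $P=\{P_1,\dots,P_s\}$ and each $P_k\in P$, $\sum_{i\in P_k}R_i(D)=R_k(\hat D)$, where $\hat D=(\{1,\dots,s\},\hat P^s,\hat N,\hat\pi,\hat C)\in\mathcal{D}^0$ is the *reduced problem*: $\hat P^s=\{\{1\},\dots,\{s\}\}$, $\hat N^0=N^0$ and all other holder sets are empty, $\hat\pi^0=\pi^0$, $\hat\pi^{-t}=\hat\pi^t=\pi^t$ for each $t\in\{1,\dots,s\}$, and $\hat C^0_{ta}=1$ if there is $i\in P_t$ with $C^0_{ia}=1$ and $\hat C^0_{ta}=0$ otherwise. *)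

theory Defs
  imports Complex_Main "HOL-Library.Disjoint_Sets"
begin

text \<open>
  Museums are elements of a set \<open>MM :: 'm set\<close> and pass holders elements of a set \<open>NN :: 'h set\<close>.
  The positive integers are contained in \<open>MM\<close> through an injection \<open>\<iota> :: nat \<Rightarrow> 'm\<close> of \<open>{1..}\<close>.

  Pass indices: \<open>Individual i\<close> is the superscript $-i$, \<open>General\<close> is the superscript $0$, and
  \<open>Consortium Q\<close> is the superscript of the consortium \<open>Q\<close>.  Consortia are indexed by
  themselves, so no enumeration of the partition is part of a problem.
\<close>

datatype 'm pass = Individual 'm | General | Consortium "'m set"

record ('m, 'h) problem =
  museums :: "'m set"
  consortia :: "'m set set"
  holders :: "'m pass \<Rightarrow> 'h set"
  price :: "'m pass \<Rightarrow> real"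
  visits :: "'m pass \<Rightarrow> 'm \<Rightarrow> 'h \<Rightarrow> nat"

definition passes :: "('m, 'h) problem \<Rightarrow> 'm pass set" where
  "passes D = Individual ` museums D \<union> {General} \<union> Consortium ` consortia D"

definition rows :: "('m, 'h) problem \<Rightarrow> 'm pass \<Rightarrow> 'm set" where
  "rows D \<sigma> = (case \<sigma> of Individual i \<Rightarrow> {i} | General \<Rightarrow> museums D | Consortium Q \<Rightarrow> Q)"

text \<open>
  The last three conditions give the total functions a fixed value outside the index sets of the
  problem, so that two records in \<open>problems MM NN\<close> are equal exactly when they are the same 5-tuple;
  hence a function on records is a function on problems.
\<close>

definition problems :: "'m set \<Rightarrow> 'h set \<Rightarrow> ('m, 'h) problem set" where
  "problems MM NN = {D.
     finite (museums D) \<and> museums D \<noteq> {} \<and> museums D \<subseteq> MM \<and>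
     partition_on (museums D) (consortia D) \<and>
     (\<forall>\<sigma>\<in>passes D. finite (holders D \<sigma>) \<and> holders D \<sigma> \<subseteq> NN) \<and>
     disjoint_family_on (holders D) (passes D) \<and>
     (\<forall>i. {i} \<in> consortia D \<longrightarrow> holders D (Individual i) = {}) \<and>
     (\<forall>\<sigma>\<in>passes D. price D \<sigma> > 0) \<and>
     (\<forall>i. {i} \<in> consortia D \<longrightarrow> price D (Individual i) = price D (Consortium {i})) \<and>
     (\<forall>\<sigma>\<in>passes D. \<forall>i\<in>rows D \<sigma>. \<forall>a\<in>holders D \<sigma>. visits D \<sigma> i a \<in> {0, 1}) \<and>
     (\<forall>\<sigma>\<in>passes D. \<forall>a\<in>holders D \<sigma>. \<exists>i\<in>rows D \<sigma>. visits D \<sigma> i a = 1) \<and>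
     (\<forall>\<sigma>. \<sigma> \<notin> passes D \<longrightarrow> holders D \<sigma> = {}) \<and>
     (\<forall>\<sigma>. \<sigma> \<notin> passes D \<longrightarrow> price D \<sigma> = 0) \<and>
     (\<forall>\<sigma> i a. \<sigma> \<notin> passes D \<or> i \<notin> rows D \<sigma> \<or> a \<notin> holders D \<sigma> \<longrightarrow> visits D \<sigma> i a = 0)}"

definition problems0 :: "'m set \<Rightarrow> 'h set \<Rightarrow> ('m, 'h) problem set" where
  "problems0 MM NN =
     {D \<in> problems MM NN. \<forall>\<sigma>\<in>passes D. \<sigma> \<noteq> General \<longrightarrow> holders D \<sigma> = {}}"

definition consortium_of :: "('m, 'h) problem \<Rightarrow> 'm \<Rightarrow> 'm set" where
  "consortium_of D i = (THE Q. Q \<in> consortia D \<and> i \<in> Q)"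

definition visitors :: "('m, 'h) problem \<Rightarrow> 'm pass \<Rightarrow> 'm \<Rightarrow> 'h set" where
  "visitors D \<sigma> i = {a \<in> holders D \<sigma>. visits D \<sigma> i a = 1}"

definition visited_museums :: "('m, 'h) problem \<Rightarrow> 'h \<Rightarrow> 'm set" where
  "visited_museums D a = {i \<in> museums D. \<exists>\<sigma>\<in>passes D. a \<in> visitors D \<sigma> i}"

definition visited_consortia :: "('m, 'h) problem \<Rightarrow> 'h \<Rightarrow> 'm set set" where
  "visited_consortia D a = {Q \<in> consortia D. \<exists>i\<in>Q. visits D General i a = 1}"

definition revenue :: "('m, 'h) problem \<Rightarrow> real" where
  "revenue D =
     (\<Sum>i\<in>museums D. real (card (holders D (Individual i))) * price D (Individual i)) +
     real (card (holders D General)) * price D General +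
     (\<Sum>Q\<in>consortia D. real (card (holders D (Consortium Q))) * price D (Consortium Q))"

text \<open>
  Only the values \<open>R D i\<close> with \<open>D \<in> problems MM NN\<close> and \<open>i \<in> museums D\<close> are meaningful;
  nothing below constrains any others.
\<close>

definition is_rule ::
    "'m set \<Rightarrow> 'h set \<Rightarrow> (('m, 'h) problem \<Rightarrow> 'm \<Rightarrow> real) \<Rightarrow> bool" where
  "is_rule MM NN R \<longleftrightarrow>
     (\<forall>D\<in>problems MM NN. (\<forall>i\<in>museums D. R D i \<ge> 0) \<and> (\<Sum>i\<in>museums D. R D i) = revenue D)"

definition combine ::
    "('m, 'h) problem \<Rightarrow> ('m, 'h) problem \<Rightarrow> ('m, 'h) problem" where
  "combine D1 D2 =
     \<lparr>museums = museums D1, consortia = consortia D1,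
      holders = (\<lambda>\<sigma>. holders D1 \<sigma> \<union> holders D2 \<sigma>),
      price = price D1,
      visits = (\<lambda>\<sigma> i a. if a \<in> holders D1 \<sigma> then visits D1 \<sigma> i a else visits D2 \<sigma> i a)\<rparr>"

definition composition ::
    "'m set \<Rightarrow> 'h set \<Rightarrow> (('m, 'h) problem \<Rightarrow> 'm \<Rightarrow> real) \<Rightarrow> bool" where
  "composition MM NN R \<longleftrightarrow>
     (\<forall>D1\<in>problems MM NN. \<forall>D2\<in>problems MM NN.
        museums D1 = museums D2 \<and> consortia D1 = consortia D2 \<and> price D1 = price D2 \<and>
        (\<Union>\<sigma>\<in>passes D1. holders D1 \<sigma>) \<inter> (\<Union>\<sigma>\<in>passes D2. holders D2 \<sigma>) = {} \<longrightarrow>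
        (\<forall>i\<in>museums D1. R (combine D1 D2) i = R D1 i + R D2 i))"

definition dummy ::
    "'m set \<Rightarrow> 'h set \<Rightarrow> (('m, 'h) problem \<Rightarrow> 'm \<Rightarrow> real) \<Rightarrow> bool" where
  "dummy MM NN R \<longleftrightarrow>
     (\<forall>D\<in>problems MM NN. \<forall>i\<in>museums D.
        (\<forall>\<sigma>\<in>{Individual i, General, Consortium (consortium_of D i)}.
           \<forall>a\<in>holders D \<sigma>. visits D \<sigma> i a = 0) \<longrightarrow>
        R D i = 0)"

definition symmetry_within_consortia ::
    "'m set \<Rightarrow> 'h set \<Rightarrow> (('m, 'h) problem \<Rightarrow> 'm \<Rightarrow> real) \<Rightarrow> bool" where
  "symmetry_within_consortia MM NN R \<longleftrightarrow>
     (\<forall>D\<in>problems MM NN. \<forall>i\<in>museums D. \<forall>j\<in>museums D.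
        consortium_of D i = consortium_of D j \<and>
        (\<forall>a\<in>holders D General. visits D General i a = visits D General j a) \<and>
        (\<forall>a\<in>holders D (Consortium (consortium_of D i)).
           visits D (Consortium (consortium_of D i)) i a =
           visits D (Consortium (consortium_of D j)) j a) \<and>
        price D (Individual i) * real (card (holders D (Individual i))) =
        price D (Individual j) * real (card (holders D (Individual j))) \<longrightarrow>
        R D i = R D j)"

text \<open>
  \<open>split_of MM D Q t \<phi> D'\<close>: the problem \<open>D'\<close> arises from \<open>D\<close> by splitting the consortium \<open>Q\<close>
  into the \<open>t\<close> consortia \<open>\<phi> l ` Q\<close>, where \<open>\<phi> l h\<close> is the \<open>l\<close>-th successor of the museum \<open>h \<in> Q\<close>.
  That different copies of a holder set are disjoint, and that the new prices are positive,
  is part of \<open>D' \<in> problems MM NN\<close>, which \<open>splitting_proofness\<close> requires.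
  The successors may reuse museums of \<open>Q\<close>.
\<close>

definition split_of ::
    "'m set \<Rightarrow> ('m, 'h) problem \<Rightarrow> 'm set \<Rightarrow> nat \<Rightarrow> (nat \<Rightarrow> 'm \<Rightarrow> 'm) \<Rightarrow> ('m, 'h) problem \<Rightarrow> bool"
where
  "split_of MM D Q t \<phi> D' \<longleftrightarrow>
     Q \<in> consortia D \<and>
     inj_on (\<lambda>(l, h). \<phi> l h) ({1..t} \<times> Q) \<and>
     (\<forall>l\<in>{1..t}. \<forall>h\<in>Q. \<phi> l h \<in> MM - (museums D - Q)) \<and>
     museums D' = (museums D - Q) \<union> (\<Union>l\<in>{1..t}. \<phi> l ` Q) \<and>
     consortia D' = (consortia D - {Q}) \<union> (\<lambda>l. \<phi> l ` Q) ` {1..t} \<and>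
     \<comment> \<open>passes of the new consortia and of their museums\<close>
     (\<forall>l\<in>{1..t}. \<exists>\<beta>.
        bij_betw \<beta> (holders D (Consortium Q)) (holders D' (Consortium (\<phi> l ` Q))) \<and>
        (\<forall>h\<in>Q. \<forall>a\<in>holders D (Consortium Q).
           visits D' (Consortium (\<phi> l ` Q)) (\<phi> l h) (\<beta> a) = visits D (Consortium Q) h a)) \<and>
     (\<forall>l\<in>{1..t}. \<forall>h\<in>Q. \<exists>\<beta>.
        bij_betw \<beta> (holders D (Individual h)) (holders D' (Individual (\<phi> l h))) \<and>
        (\<forall>a\<in>holders D (Individual h).
           visits D' (Individual (\<phi> l h)) (\<phi> l h) (\<beta> a) = visits D (Individual h) h a)) \<and>
     (\<Sum>l\<in>{1..t}. price D' (Consortium (\<phi> l ` Q))) = price D (Consortium Q) \<and>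
     (\<forall>h\<in>Q. (\<Sum>l\<in>{1..t}. price D' (Individual (\<phi> l h))) = price D (Individual h)) \<and>
     \<comment> \<open>general pass\<close>
     holders D' General = holders D General \<and>
     price D' General = price D General \<and>
     (\<forall>l\<in>{1..t}. \<forall>h\<in>Q. \<forall>a\<in>holders D General.
        visits D' General (\<phi> l h) a = visits D General h a) \<and>
     (\<forall>i\<in>museums D - Q. \<forall>a\<in>holders D General.
        visits D' General i a = visits D General i a) \<and>
     \<comment> \<open>passes of the other consortia and of their museums\<close>
     (\<forall>\<sigma> \<in> Individual ` (museums D - Q) \<union> Consortium ` (consortia D - {Q}).
        holders D' \<sigma> = holders D \<sigma> \<and>
        price D' \<sigma> = price D \<sigma> \<and>
        (\<forall>i\<in>rows D \<sigma>. \<forall>a\<in>holders D \<sigma>. visits D' \<sigma> i a = visits D \<sigma> i a))"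

definition splitting_proofness ::
    "'m set \<Rightarrow> 'h set \<Rightarrow> (('m, 'h) problem \<Rightarrow> 'm \<Rightarrow> real) \<Rightarrow> bool" where
  "splitting_proofness MM NN R \<longleftrightarrow>
     (\<forall>D\<in>problems MM NN. \<forall>D'\<in>problems MM NN. \<forall>Q t \<phi>.
        split_of MM D Q t \<phi> D' \<longrightarrow>
        (\<forall>Q'\<in>consortia D - {Q}. (\<Sum>j\<in>Q'. R D j) = (\<Sum>j\<in>Q'. R D' j)))"

text \<open>
  The reduced problem of \<open>D\<close> for the enumeration \<open>e 1, \<dots>, e s\<close> of the consortia of \<open>D\<close>;
  \<open>back i\<close> is the consortium of \<open>D\<close> that museum \<open>i\<close> of the reduced problem stands for.
\<close>

definition reduced ::
    "(nat \<Rightarrow> 'm) \<Rightarrow> (nat \<Rightarrow> 'm set) \<Rightarrow> ('m, 'h) problem \<Rightarrow> ('m, 'h) problem" where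
  "reduced \<iota> e D =
     (let s = card (consortia D);
          M = \<iota> ` {1..s};
          back = (\<lambda>i. e (inv_into {1..s} \<iota> i))
      in \<lparr>museums = M,
          consortia = (\<lambda>i. {i}) ` M,
          holders = (\<lambda>\<sigma>. if \<sigma> = General then holders D General else {}),
          price = (\<lambda>\<sigma>. case \<sigma> of
              Individual i \<Rightarrow> if i \<in> M then price D (Consortium (back i)) else 0
            | General \<Rightarrow> price D General
            | Consortium Q \<Rightarrow>
                if \<exists>i\<in>M. Q = {i} then price D (Consortium (back (the_elem Q))) else 0),
          visits = (\<lambda>\<sigma> i a.
            if \<sigma> = General \<and> i \<in> M \<and> a \<in> holders D General \<and>
               (\<exists>j\<in>back i. visits D General j a = 1)
            then 1 else 0)\<rparr>)"

definition consortia_consistency ::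
    "'m set \<Rightarrow> 'h set \<Rightarrow> (nat \<Rightarrow> 'm) \<Rightarrow> (('m, 'h) problem \<Rightarrow> 'm \<Rightarrow> real) \<Rightarrow> bool" where
  "consortia_consistency MM NN \<iota> R \<longleftrightarrow>
     (\<forall>D\<in>problems0 MM NN. \<forall>e. bij_betw e {1..card (consortia D)} (consortia D) \<longrightarrow>
        (\<forall>k\<in>{1..card (consortia D)}. (\<Sum>i\<in>e k. R D i) = R (reduced \<iota> e D) (\<iota> k)))"

definition proportional_egalitarian :: "('m, 'h) problem \<Rightarrow> 'm \<Rightarrow> real" where
  "proportional_egalitarian D i =
     (\<Sum>a\<in>visitors D General i.
        1 / real (card (visited_museums D a \<inter> consortium_of D i)) *
        (price D (Consortium (consortium_of D i)) /
          (\<Sum>Q\<in>visited_consortia D a. price D (Consortium Q))) *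
        price D General) +
     (\<Sum>a\<in>visitors D (Consortium (consortium_of D i)) i.
        1 / real (card (visited_museums D a)) * price D (Consortium (consortium_of D i))) +
     real (card (holders D (Individual i))) * price D (Individual i)"

end

theory Submission
  imports Defs
begin

text \<open>
  By composition and dummy it suffices to treat problems with a single holder.  Holders of an
  individual or a consortium pass are settled by dummy, symmetry and the revenue.  For a holder of
  the general pass, consortia consistency leads to singleton consortia.  Applied to two enumerations
  that differ by a transposition, it shows that visited consortia of equal price have equal shares.
  Splitting-proofness makes shares additive in the price, and since they are nonnegative they are
  proportional to the prices.  The share of a consortium is distributed by dummy and symmetry.
\<close>

text \<open>Symmetry relates museums of one consortium only, so it is void when all consortia are
  singletons; this is why distinct consortia have to be compared through enumerations.
  Splitting-proofness in turn is silent about the consortium that is split. That its successors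
  inherit its share comes from the revenue: all other shares and the total stay the same. Two prices
  may be incommensurable, so two consortia need not have a common subdivision into parts of equal
  price. Cutting parts of one price off both leaves a remainder at one of them, whose share is only
  known to be nonnegative. This gives an inequality for each rational ratio, and density of the
  rationals turns the inequalities into proportionality. The infinitude of \<open>MM\<close>
  supplies the fresh museums for the parts. For arbitrary consortia the shares are not computed.
  \<open>R\<close> and \<open>proportional_egalitarian\<close> are treated as two functions that
  both satisfy consistency, dummy and symmetry and agree on the reduced problem.\<close>

declare One_nat_def [simp del]

section \<open>Problems\<close>

lemma problem_museums:
  assumes "D \<in> problems MM NN"
  shows "finite (museums D)" "museums D \<noteq> {}" "museums D \<subseteq> MM"
    "partition_on (museums D) (consortia D)" "finite (consortia D)"
  using assms finite_elements unfolding problems_def by auto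

lemma passes_simps [simp]:
  "Individual i \<in> passes D \<longleftrightarrow> i \<in> museums D"
  "General \<in> passes D"
  "Consortium Q \<in> passes D \<longleftrightarrow> Q \<in> consortia D"
  by (auto simp: passes_def)

lemma rows_simps [simp]:
  "rows D (Individual i) = {i}" "rows D General = museums D" "rows D (Consortium Q) = Q"
  by (auto simp: rows_def)

lemma consortium_subset:
  assumes "D \<in> problems MM NN" "Q \<in> consortia D"
  shows "Q \<subseteq> museums D" "Q \<noteq> {}" "finite Q"
proof -
  show "Q \<subseteq> museums D" "Q \<noteq> {}"
    using problem_museums(4)[OF assms(1)] assms(2) by (auto simp: partition_on_def)
  then show "finite Q"
    using problem_museums(1)[OF assms(1)] finite_subset by blast
qed

lemma consortium_unique:
  assumes "D \<in> problems MM NN" "Q \<in> consortia D" "Q' \<in> consortia D" "i \<in> Q" "i \<in> Q'"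
  shows "Q = Q'"
  using disjointD[OF partition_onD2[OF problem_museums(4)[OF assms(1)]] assms(2,3)] assms(4,5)
  by blast

lemma consortium_of_eq:
  assumes "D \<in> problems MM NN" "Q \<in> consortia D" "i \<in> Q"
  shows "consortium_of D i = Q"
  unfolding consortium_of_def using assms consortium_unique[OF assms(1) _ assms(2) _ assms(3)]
  by (intro the_equality) blast+

lemma consortium_of_mem:
  assumes "D \<in> problems MM NN" "i \<in> museums D"
  shows "consortium_of D i \<in> consortia D" "i \<in> consortium_of D i"
proof -
  obtain Q where Q: "Q \<in> consortia D" "i \<in> Q"
    using problem_museums(4)[OF assms(1)] assms(2) by (auto simp: partition_on_def)
  then show "consortium_of D i \<in> consortia D" "i \<in> consortium_of D i"
    using consortium_of_eq[OF assms(1) Q] by auto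
qed

lemma problemD:
  assumes "D \<in> problems MM NN"
  shows "\<forall>\<sigma>\<in>passes D. finite (holders D \<sigma>) \<and> holders D \<sigma> \<subseteq> NN"
    and "disjoint_family_on (holders D) (passes D)"
    and "\<forall>i. {i} \<in> consortia D \<longrightarrow> holders D (Individual i) = {}"
    and "\<forall>\<sigma>\<in>passes D. price D \<sigma> > 0"
    and "\<forall>i. {i} \<in> consortia D \<longrightarrow> price D (Individual i) = price D (Consortium {i})"
    and "\<forall>\<sigma>\<in>passes D. \<forall>i\<in>rows D \<sigma>. \<forall>a\<in>holders D \<sigma>. visits D \<sigma> i a \<in> {0, 1}"
    and "\<forall>\<sigma>\<in>passes D. \<forall>a\<in>holders D \<sigma>. \<exists>i\<in>rows D \<sigma>. visits D \<sigma> i a = 1"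
    and "\<forall>\<sigma>. \<sigma> \<notin> passes D \<longrightarrow> holders D \<sigma> = {}"
    and "\<forall>\<sigma>. \<sigma> \<notin> passes D \<longrightarrow> price D \<sigma> = 0"
    and "\<forall>\<sigma> i a. \<sigma> \<notin> passes D \<or> i \<notin> rows D \<sigma> \<or> a \<notin> holders D \<sigma> \<longrightarrow> visits D \<sigma> i a = 0"
  using assms unfolding problems_def mem_Collect_eq by - (elim conjE, assumption)+

text \<open>Valid for every \<open>\<sigma>\<close>, since the normalisation in
  \<open>problems\<close> makes the holder set empty outside \<open>passes D\<close>.\<close>

lemma problem_holders:
  assumes "D \<in> problems MM NN"
  shows "finite (holders D \<sigma>)" "holders D \<sigma> \<subseteq> NN" "a \<in> holders D \<sigma> \<Longrightarrow> \<sigma> \<in> passes D"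
proof -
  show "a \<in> holders D \<sigma> \<Longrightarrow> \<sigma> \<in> passes D"
    using problemD(8)[OF assms] by blast
  show "finite (holders D \<sigma>)" "holders D \<sigma> \<subseteq> NN"
    using problemD(1,8)[OF assms] by (metis finite.emptyI empty_subsetI)+
qed

lemma holders_unique:
  assumes "D \<in> problems MM NN" "a \<in> holders D \<sigma>" "a \<in> holders D \<tau>"
  shows "\<sigma> = \<tau>"
  using assms(2,3) problem_holders(3)[OF assms(1)] problemD(2)[OF assms(1)]
  unfolding disjoint_family_on_def by blast

lemma problem_prices:
  assumes "D \<in> problems MM NN"
  shows "\<sigma> \<in> passes D \<Longrightarrow> price D \<sigma> > 0"
    "{i} \<in> consortia D \<Longrightarrow> price D (Individual i) = price D (Consortium {i})"
    "{i} \<in> consortia D \<Longrightarrow> holders D (Individual i) = {}"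
    "\<sigma> \<notin> passes D \<Longrightarrow> price D \<sigma> = 0"
  using problemD(3,4,5,9)[OF assms] by blast+

lemma visits_01:
  assumes "D \<in> problems MM NN"
  shows "visits D \<sigma> i a = 0 \<or> visits D \<sigma> i a = 1"
  using problemD(6,10)[OF assms] by blast

lemma visits_1D:
  assumes "D \<in> problems MM NN" "visits D \<sigma> i a = 1"
  shows "\<sigma> \<in> passes D" "i \<in> rows D \<sigma>" "a \<in> holders D \<sigma>"
  using problemD(10)[OF assms(1)] assms(2) by (metis zero_neq_one)+

lemma holder_visits:
  assumes "D \<in> problems MM NN" "a \<in> holders D \<sigma>"
  shows "\<exists>i. visits D \<sigma> i a = 1"
  using problem_holders(3)[OF assms] problemD(7)[OF assms(1)] assms(2) by blast

lemma visits_museum: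
  assumes "D \<in> problems MM NN" "visits D \<sigma> i a = 1"
  shows "i \<in> museums D"
  using visits_1D[OF assms] consortium_subset(1)[OF assms(1)] by (cases \<sigma>) auto

lemma visitors_eq:
  assumes "D \<in> problems MM NN"
  shows "visitors D \<sigma> i = {a. visits D \<sigma> i a = 1}"
  using visits_1D[OF assms] by (auto simp: visitors_def)

lemma finite_visitors: "D \<in> problems MM NN \<Longrightarrow> finite (visitors D \<sigma> i)"
  using problem_holders(1)[of D MM NN \<sigma>] by (simp add: visitors_def)

text \<open>Holder sets of different passes are disjoint, so a holder owns one pass only and the
  quantifier over passes in \<open>visited_museums\<close> collapses to that pass.\<close>

lemma visited_museums_eq:
  assumes "D \<in> problems MM NN" "a \<in> holders D \<sigma>"
  shows "visited_museums D a = {i. visits D \<sigma> i a = 1}"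
proof -
  have "\<tau> = \<sigma>" if "visits D \<tau> i a = 1" for \<tau> i
    using holders_unique[OF assms(1)] visits_1D(3)[OF assms(1) that] assms(2) by blast
  then show ?thesis
    using visits_museum[OF assms(1)] visits_1D(1)[OF assms(1)]
    unfolding visited_museums_def visitors_eq[OF assms(1)] mem_Collect_eq by blast
qed

lemma visited_museums_finite:
  assumes "D \<in> problems MM NN" 
  shows "finite (visited_museums D a)"
  using problem_museums(1)[OF assms] by (auto simp: visited_museums_def)

section \<open>The proportional-egalitarian rule satisfies the axioms\<close>

text \<open>The values of a rule are constrained on \<open>problems MM NN\<close> only, so using
  composition for a rule known there requires this membership. Since no holder occurs on both sides,
  the united holder sets are again pairwise disjoint.\<close>

lemma combine_in_problems:
  assumes D1: "D1 \<in> problems MM NN" and D2: "D2 \<in> problems MM NN"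
    and eq: "museums D1 = museums D2" "consortia D1 = consortia D2" "price D1 = price D2"
    and disj: "(\<Union>\<sigma>\<in>passes D1. holders D1 \<sigma>) \<inter> (\<Union>\<sigma>\<in>passes D2. holders D2 \<sigma>) = {}"
  shows "combine D1 D2 \<in> problems MM NN"
proof -
  have ps: "passes (combine D1 D2) = passes D1" "passes D2 = passes D1"
    and rs: "rows (combine D1 D2) = rows D1" "rows D2 = rows D1"
    by (auto simp: passes_def combine_def rows_def fun_eq_iff eq split: pass.splits)
  have dj: "a \<notin> holders D2 \<tau>" if "a \<in> holders D1 \<sigma>" for a \<sigma> \<tau>
    using disj that problem_holders(3)[OF D1] problem_holders(3)[OF D2] by blast
  have "disjoint_family_on (holders (combine D1 D2)) (passes D1)"
    unfolding disjoint_family_on_def combine_def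
    using dj holders_unique[OF D1] holders_unique[OF D2] by auto
  moreover have "\<exists>i\<in>rows D1 \<sigma>. visits (combine D1 D2) \<sigma> i a = 1"
    if "a \<in> holders (combine D1 D2) \<sigma>" for \<sigma> a
    using that holder_visits[OF D1, of a \<sigma>] holder_visits[OF D2, of a \<sigma>]
      visits_1D(2)[OF D1, of \<sigma> _ a] visits_1D(2)[OF D2, of \<sigma> _ a] dj
    by (fastforce simp: combine_def rs)
  moreover have "visits (combine D1 D2) \<sigma> i a \<in> {0, 1}" for \<sigma> i a
    using visits_01[OF D1, of \<sigma> i a] visits_01[OF D2, of \<sigma> i a] by (auto simp: combine_def)
  moreover have "visits (combine D1 D2) \<sigma> i a = 0"
    if "\<sigma> \<notin> passes D1 \<or> i \<notin> rows D1 \<sigma> \<or> a \<notin> holders (combine D1 D2) \<sigma>" for \<sigma> i a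
    using that visits_01[OF D1, of \<sigma> i a] visits_01[OF D2, of \<sigma> i a]
      visits_1D[OF D1, of \<sigma> i a] visits_1D[OF D2, of \<sigma> i a] ps rs by (auto simp: combine_def)
  ultimately show ?thesis
    unfolding problems_def mem_Collect_eq ps rs
    using problem_museums[OF D1] problem_holders[OF D1] problem_holders[OF D2]
      problem_prices[OF D1] problem_prices[OF D2]
    by (auto simp: combine_def eq ps)
qed

text \<open>Each summand of the rule belongs to one holder and depends only on the prices and on the
  column of that holder. Both survive in the combined problem.\<close>

lemma proportional_egalitarian_combine:
  assumes D1: "D1 \<in> problems MM NN" and D2: "D2 \<in> problems MM NN"
    and eq: "museums D1 = museums D2" "consortia D1 = consortia D2" "price D1 = price D2"
    and disj: "(\<Union>\<sigma>\<in>passes D1. holders D1 \<sigma>) \<inter> (\<Union>\<sigma>\<in>passes D2. holders D2 \<sigma>) = {}"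
  shows "proportional_egalitarian (combine D1 D2) i =
    proportional_egalitarian D1 i + proportional_egalitarian D2 i"
proof -
  let ?D = "combine D1 D2"
  have D: "?D \<in> problems MM NN"
    using combine_in_problems[OF assms] .
  have dj: "a \<notin> holders D2 \<tau>" if "a \<in> holders D1 \<sigma>" for a \<sigma> \<tau>
    using disj that problem_holders(3)[OF D1] problem_holders(3)[OF D2] by blast
  have co: "consortium_of ?D = consortium_of D1" "consortium_of D2 = consortium_of D1"
    by (auto simp: consortium_of_def combine_def fun_eq_iff eq)
  have vs1: "visits ?D \<sigma> i a = visits D1 \<sigma> i a" if "a \<in> holders D1 \<sigma>" for \<sigma> i a
    using that by (auto simp: combine_def)
  \<comment> \<open>\<open>combine\<close> consults \<open>D1\<close> first; the columns of
    \<open>D2\<close> survive because no holder is shared.\<close>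
  have vs2: "visits ?D \<sigma> i a = visits D2 \<sigma> i a" if "a \<in> holders D2 \<sigma>" for \<sigma> i a
    using that dj by (auto simp: combine_def)
  have h: "holders ?D \<sigma> = holders D1 \<sigma> \<union> holders D2 \<sigma>" for \<sigma>
    by (simp add: combine_def)
  have vu: "visitors ?D \<sigma> i = visitors D1 \<sigma> i \<union> visitors D2 \<sigma> i" for \<sigma> i
    using vs1 vs2 by (auto simp: visitors_def h)
  have vd: "visitors D1 \<sigma> i \<inter> visitors D2 \<sigma> i = {}" for \<sigma> i
    using dj by (auto simp: visitors_def)
  have vm1: "visited_museums ?D a = visited_museums D1 a" if "a \<in> holders D1 \<sigma>" for \<sigma> a
    using that visited_museums_eq[OF D, of a \<sigma>] visited_museums_eq[OF D1, of a \<sigma>] vs1 h by auto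
  have vm2: "visited_museums ?D a = visited_museums D2 a" if "a \<in> holders D2 \<sigma>" for \<sigma> a
    using that visited_museums_eq[OF D, of a \<sigma>] visited_museums_eq[OF D2, of a \<sigma>] vs2 h by auto
  have vc1: "visited_consortia ?D a = visited_consortia D1 a" if "a \<in> holders D1 General" for a
    using that vs1 by (auto simp: visited_consortia_def combine_def)
  have vc2: "visited_consortia ?D a = visited_consortia D2 a" if "a \<in> holders D2 General" for a
    using that vs2 by (auto simp: visited_consortia_def eq, auto simp: combine_def eq)
  have pr: "price ?D = price D1" "price D2 = price D1"
    by (auto simp: combine_def eq)
  have mem: "a \<in> holders D' \<sigma>" if "a \<in> visitors D' \<sigma> i" for a \<sigma> and D' :: "('a, 'b) problem"
    using that by (auto simp: visitors_def)
  have cd: "card (holders ?D \<sigma>) = card (holders D1 \<sigma>) + card (holders D2 \<sigma>)" for \<sigma>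
    unfolding h by (rule card_Un_disjoint) (use problem_holders(1) D1 D2 dj in auto)
  have split: "(\<Sum>a\<in>visitors ?D \<sigma> i. f a) = (\<Sum>a\<in>visitors D1 \<sigma> i. f1 a) + (\<Sum>a\<in>visitors D2 \<sigma> i. f2 a)"
    if "\<And>a. a \<in> holders D1 \<sigma> \<Longrightarrow> f a = f1 a" "\<And>a. a \<in> holders D2 \<sigma> \<Longrightarrow> f a = f2 a"
    for f f1 f2 :: "_ \<Rightarrow> real" and \<sigma>
    unfolding vu sum.union_disjoint[OF finite_visitors[OF D1] finite_visitors[OF D2] vd]
    using that mem by (auto intro!: arg_cong2[of _ _ _ _ "(+)"] sum.cong)
  show ?thesis
    unfolding proportional_egalitarian_def co pr cd
    apply (subst split[of General, OF refl refl])
    apply (subst split[of "Consortium (consortium_of D1 i)", OF refl refl])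
    apply (simp add: vm1[of _ General] vm2[of _ General] vm1[of _ "Consortium (consortium_of D1 i)"]
        vm2[of _ "Consortium (consortium_of D1 i)"] vc1 vc2 mem algebra_simps cong: sum.cong)
    done
qed

lemma proportional_egalitarian_dummy:
  assumes D: "D \<in> problems MM NN" and "i \<in> museums D"
    and 0: "\<forall>\<sigma>\<in>{Individual i, General, Consortium (consortium_of D i)}.
      \<forall>a\<in>holders D \<sigma>. visits D \<sigma> i a = 0"
  shows "proportional_egalitarian D i = 0"
proof -
  have "visitors D General i = {}" "visitors D (Consortium (consortium_of D i)) i = {}"
    using 0 by (auto simp: visitors_def)
  \<comment> \<open>An individual pass has \<open>i\<close> as its only row, so a holder of it would
    force an entry 1 that the hypothesis excludes.\<close>
  moreover have "holders D (Individual i) = {}"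
  proof (rule ccontr)
    assume "holders D (Individual i) \<noteq> {}"
    then obtain a j where "a \<in> holders D (Individual i)" "visits D (Individual i) j a = 1"
      using holder_visits[OF D] by blast
    then show False
      using 0 visits_1D(2)[OF D, of "Individual i" j a] by auto
  qed
  ultimately show ?thesis
    by (simp add: proportional_egalitarian_def)
qed

lemma proportional_egalitarian_symmetry:
  assumes co: "consortium_of D i = consortium_of D j"
    and G: "\<forall>a\<in>holders D General. visits D General i a = visits D General j a"
    and C: "\<forall>a\<in>holders D (Consortium (consortium_of D i)).
       visits D (Consortium (consortium_of D i)) i a =
       visits D (Consortium (consortium_of D j)) j a"
    and I: "price D (Individual i) * real (card (holders D (Individual i))) =
      price D (Individual j) * real (card (holders D (Individual j)))"
  shows "proportional_egalitarian D i = proportional_egalitarian D j"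
proof -
  have "visitors D General i = visitors D General j"
    "visitors D (Consortium (consortium_of D i)) i = visitors D (Consortium (consortium_of D j)) j"
    using G C co by (auto simp: visitors_def)
  then show ?thesis
    using I co by (simp add: proportional_egalitarian_def mult.commute)
qed

text \<open>A holder of the general pass visits all successors of \<open>Q\<close> or none,
  according to whether \<open>Q\<close> was visited, and the prices of the successors add up to the
  price of \<open>Q\<close>. Hence the denominators do not change, and everything else in the share
  of \<open>j\<close> is local to \<open>Q'\<close>. The equality holds for each museum and not just
  for the sum over a consortium.\<close>

lemma proportional_egalitarian_split:
  assumes D: "D \<in> problems MM NN" and D': "D' \<in> problems MM NN"
    and sp: "split_of MM D Q t \<phi> D'" and Q': "Q' \<in> consortia D - {Q}" and j: "j \<in> Q'"
  shows "proportional_egalitarian D j = proportional_egalitarian D' j"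
proof -
  have Q: "Q \<in> consortia D"
    and inj: "inj_on (\<lambda>(l, h). \<phi> l h) ({1..t} \<times> Q)"
    and fresh: "\<forall>l\<in>{1..t}. \<forall>h\<in>Q. \<phi> l h \<in> MM - (museums D - Q)"
    and cons: "consortia D' = (consortia D - {Q}) \<union> (\<lambda>l. \<phi> l ` Q) ` {1..t}"
    and psum: "(\<Sum>l\<in>{1..t}. price D' (Consortium (\<phi> l ` Q))) = price D (Consortium Q)"
    and G: "holders D' General = holders D General" "price D' General = price D General"
    and G1: "\<forall>l\<in>{1..t}. \<forall>h\<in>Q. \<forall>a\<in>holders D General.
        visits D' General (\<phi> l h) a = visits D General h a"
    and G2: "\<forall>i\<in>museums D - Q. \<forall>a\<in>holders D General.
        visits D' General i a = visits D General i a"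
    and oth: "\<forall>\<sigma> \<in> Individual ` (museums D - Q) \<union> Consortium ` (consortia D - {Q}).
        holders D' \<sigma> = holders D \<sigma> \<and> price D' \<sigma> = price D \<sigma> \<and>
        (\<forall>i\<in>rows D \<sigma>. \<forall>a\<in>holders D \<sigma>. visits D' \<sigma> i a = visits D \<sigma> i a)"
    using sp unfolding split_of_def by - (elim conjE, assumption)+
  have sub: "Q'' \<subseteq> museums D - Q" if "Q'' \<in> consortia D - {Q}" for Q''
    using that Q consortium_unique[OF D] consortium_subset(1)[OF D] by blast
  have co: "consortium_of D j = Q'" "consortium_of D' j = Q'"
    using consortium_of_eq[OF D, of Q' j] consortium_of_eq[OF D', of Q' j] Q' j cons by auto
  have jm: "j \<in> museums D - Q"
    using sub Q' j by blast
  have vG: "visitors D' General i = visitors D General i" if "i \<in> museums D - Q" for i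
    using G G2 that by (auto simp: visitors_def)
  have oQ: "holders D' (Consortium Q') = holders D (Consortium Q')"
    "price D' (Consortium Q') = price D (Consortium Q')"
    "i \<in> Q' \<Longrightarrow> a \<in> holders D (Consortium Q') \<Longrightarrow>
      visits D' (Consortium Q') i a = visits D (Consortium Q') i a" for i a
    using bspec[OF oth, of "Consortium Q'"] Q' by auto
  have oj: "holders D' (Individual j) = holders D (Individual j)"
    "price D' (Individual j) = price D (Individual j)"
    using bspec[OF oth, of "Individual j"] jm by auto
  have vC: "visitors D' (Consortium Q') j = visitors D (Consortium Q') j"
    using oQ j by (auto simp: visitors_def)
  \<comment> \<open>Only the part inside \<open>Q'\<close> is preserved, as the museums of
    \<open>Q\<close> are replaced by their successors. For a pass of \<open>Q'\<close>, below, the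
    whole set is preserved, because all visited museums lie in \<open>Q'\<close>.\<close>
  have mG: "visited_museums D' a \<inter> Q' = visited_museums D a \<inter> Q'" if "a \<in> holders D General" for a
    using visited_museums_eq[OF D that] visited_museums_eq[OF D', of a General] that G G2 sub[OF Q']
    by auto
  have mC: "visited_museums D' a = visited_museums D a" if a: "a \<in> holders D (Consortium Q')" for a
  proof -
    have a': "a \<in> holders D' (Consortium Q')"
      using a oQ by auto
    have "visits D' (Consortium Q') i a = visits D (Consortium Q') i a" for i
    proof (cases "i \<in> Q'")
      case True
      then show ?thesis using oQ a by auto
    next
      case False
      then show ?thesis
        using visits_01[OF D, of "Consortium Q'" i a] visits_01[OF D', of "Consortium Q'" i a]
          visits_1D(2)[OF D, of "Consortium Q'" i a] visits_1D(2)[OF D', of "Consortium Q'" i a]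
        by auto
    qed
    then show ?thesis
      using visited_museums_eq[OF D a] visited_museums_eq[OF D' a'] by auto
  qed
  have Qne: "Q \<noteq> {}"
    using consortium_subset[OF D Q] by blast
  \<comment> \<open>Distinct successor consortia are needed for each new price to be counted once in
    the sum over the image.\<close>
  have injC: "inj_on (\<lambda>l. \<phi> l ` Q) {1..t}"
  proof (rule inj_onI)
    fix l l' assume l: "l \<in> {1..t}" "l' \<in> {1..t}" and eq: "\<phi> l ` Q = \<phi> l' ` Q"
    obtain h where h: "h \<in> Q" using Qne by blast
    then have "\<phi> l h \<in> \<phi> l' ` Q" using eq by auto
    then obtain h' where "h' \<in> Q" "\<phi> l h = \<phi> l' h'" by auto
    then show "l = l'"
      using inj_onD[OF inj, of "(l, h)" "(l', h')"] l h by auto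
  qed
  \<comment> \<open>Successors avoid the museums outside \<open>Q\<close>, though they may reuse
    those of \<open>Q\<close>. A new consortium may therefore be \<open>Q\<close> itself, but no
    other old one.\<close>
  have newC: "\<phi> l ` Q \<notin> consortia D - {Q}" if "l \<in> {1..t}" for l
  proof
    assume "\<phi> l ` Q \<in> consortia D - {Q}"
    then have "\<phi> l ` Q \<subseteq> museums D - Q" by (rule sub)
    moreover obtain h where "h \<in> Q" using Qne by blast
    ultimately show False using fresh that by auto
  qed
  have tot: "(\<Sum>Q\<in>visited_consortia D' a. price D' (Consortium Q)) =
      (\<Sum>Q\<in>visited_consortia D a. price D (Consortium Q))" if a: "a \<in> holders D General" for a
  proof -
    let ?new = "(\<lambda>l. \<phi> l ` Q) ` {1..t}"
    let ?V = "visited_consortia D a - {Q}"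
    have fin: "finite ?V"
      using problem_museums(5)[OF D] by (auto simp: visited_consortia_def)
    have "Q'' \<in> visited_consortia D' a \<longleftrightarrow> Q'' \<in> visited_consortia D a"
      if "Q'' \<in> consortia D - {Q}" for Q''
    proof -
      have "visits D' General i a = visits D General i a" if "i \<in> Q''" for i
        using G2 a sub[OF \<open>Q'' \<in> _\<close>] that by auto
      then show ?thesis using that cons by (auto simp: visited_consortia_def)
    qed
    moreover have "Q'' \<in> visited_consortia D' a \<longleftrightarrow> Q \<in> visited_consortia D a"
      if new: "Q'' \<in> ?new" for Q''
    proof -
      obtain l where l: "l \<in> {1..t}" "Q'' = \<phi> l ` Q" using new by auto
      then have "(\<exists>i\<in>Q''. visits D' General i a = 1) \<longleftrightarrow> (\<exists>h\<in>Q. visits D General h a = 1)"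
        using G1 a by simp
      then show ?thesis
        using new Q unfolding visited_consortia_def cons by simp
    qed
    moreover have "visited_consortia D' a \<subseteq> (consortia D - {Q}) \<union> ?new"
      unfolding visited_consortia_def cons by (rule Collect_restrict)
    moreover have "visited_consortia D a \<subseteq> consortia D"
      unfolding visited_consortia_def by (rule Collect_restrict)
    \<comment> \<open>An abstract set identity: \<open>V'\<close> agrees with \<open>V\<close> on
      the surviving consortia and contains all of the new ones or none.\<close>
    moreover have "V' = (V - {Q}) \<union> (if Q \<in> V then X else {})"
      if "\<And>Z. Z \<in> C - {Q} \<Longrightarrow> Z \<in> V' \<longleftrightarrow> Z \<in> V" "\<And>Z. Z \<in> X \<Longrightarrow> Z \<in> V' \<longleftrightarrow> Q \<in> V"
        "V' \<subseteq> (C - {Q}) \<union> X" "V \<subseteq> C" for C V V' X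
      using that by (cases "Q \<in> V") (simp, blast)+
    ultimately have V: "visited_consortia D' a =
        ?V \<union> (if Q \<in> visited_consortia D a then ?new else {})"
      by presburger
    have old: "(\<Sum>Q\<in>?V. price D' (Consortium Q)) = (\<Sum>Q\<in>?V. price D (Consortium Q))"
      using oth by (intro sum.cong) (auto simp: visited_consortia_def)
    have new: "(\<Sum>Q\<in>?new. price D' (Consortium Q)) = price D (Consortium Q)"
      by (simp add: sum.reindex[OF injC] psum)
    have dis: "?V \<inter> ?new = {}"
    proof -
      have "?V \<subseteq> consortia D - {Q}" by (auto simp: visited_consortia_def)
      moreover have "(consortia D - {Q}) \<inter> ?new = {}" 
      proof (rule equals0I, elim IntE imageE)
        fix Z l assume "Z \<in> consortia D - {Q}" "Z = \<phi> l ` Q" "l \<in> {1..t}"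
        then show False using newC[of l] by simp
      qed
      ultimately show ?thesis by blast
    qed
    show ?thesis
    proof (cases "Q \<in> visited_consortia D a")
      case True
      then have "visited_consortia D' a = ?V \<union> ?new" using V by simp
      then show ?thesis
        using sum.union_disjoint[OF fin _ dis, of "\<lambda>Q. price D' (Consortium Q)"] old new
          sum.remove[OF _ True, of "\<lambda>Q. price D (Consortium Q)"] fin
        by simp
    next
      case False
      then show ?thesis using V old by simp
    qed
  qed
  show ?thesis
    unfolding proportional_egalitarian_def co vG[OF jm] vC G(2) oQ(2) oj
    using mG mC tot by (auto simp: visitors_def intro!: sum.cong arg_cong2[of _ _ _ _ "(+)"])
qed

section \<open>Singleton consortia and the reduced problem\<close>

text \<open>The common shape of reduced problems: only general passes, at price \<open>c\<close>,
  and holder \<open>a\<close> visits \<open>K a\<close>. One function \<open>p\<close> prices both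
  the museum \<open>i\<close> and the consortium \<open>{i}\<close>, as a singleton consortium
  demands. The zero branches are the default values required by \<open>problems\<close>.\<close>

definition singleton_problem ::
    "'m set \<Rightarrow> ('m \<Rightarrow> real) \<Rightarrow> 'h set \<Rightarrow> ('h \<Rightarrow> 'm set) \<Rightarrow> real \<Rightarrow> ('m, 'h) problem" where
  "singleton_problem A p H K c =
     \<lparr>museums = A, consortia = (\<lambda>i. {i}) ` A,
      holders = (\<lambda>\<sigma>. if \<sigma> = General then H else {}),
      price = (\<lambda>\<sigma>. case \<sigma> of
          Individual i \<Rightarrow> if i \<in> A then p i else 0
        | General \<Rightarrow> c
        | Consortium Q \<Rightarrow> if \<exists>i\<in>A. Q = {i} then p (the_elem Q) else 0),
      visits = (\<lambda>\<sigma> i a. if \<sigma> = General \<and> a \<in> H \<and> i \<in> K a then 1 else 0)\<rparr>"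

lemma singleton_problem_simps [simp]:
  "museums (singleton_problem A p H K c) = A"
  "consortia (singleton_problem A p H K c) = (\<lambda>i. {i}) ` A"
  "holders (singleton_problem A p H K c) \<sigma> = (if \<sigma> = General then H else {})"
  "price (singleton_problem A p H K c) General = c"
  "i \<in> A \<Longrightarrow> price (singleton_problem A p H K c) (Individual i) = p i"
  "i \<in> A \<Longrightarrow> price (singleton_problem A p H K c) (Consortium {i}) = p i"
  "visits (singleton_problem A p H K c) \<sigma> i a =
     (if \<sigma> = General \<and> a \<in> H \<and> i \<in> K a then 1 else 0)"
  by (auto simp: singleton_problem_def)

text \<open>The record reads \<open>p\<close> on the museums and \<open>K\<close> on the holders
  only. Prices can thus be extended to fresh museums without changing the problem.\<close>

lemma singleton_problem_cong:
  assumes "A = A'" "\<And>i. i \<in> A' \<Longrightarrow> p i = p' i" "H = H'" "\<And>a. a \<in> H' \<Longrightarrow> K a = K' a" "c = c'"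
  shows "singleton_problem A p H K c = singleton_problem A' p' H' K' c'"
  using assms by (auto simp: singleton_problem_def fun_eq_iff split: pass.splits)

lemma singleton_problem_in_problems:
  assumes "finite A" "A \<noteq> {}" "A \<subseteq> MM" "finite H" "H \<subseteq> NN"
    and "\<And>a. a \<in> H \<Longrightarrow> K a \<subseteq> A" "\<And>a. a \<in> H \<Longrightarrow> K a \<noteq> {}" "\<And>i. i \<in> A \<Longrightarrow> p i > 0" "c > 0"
  shows "singleton_problem A p H K c \<in> problems MM NN"
proof -
  let ?D = "singleton_problem A p H K c"
  have "partition_on A ((\<lambda>i. {i}) ` A)"
    by (auto simp: partition_on_def disjoint_def)
  moreover have "disjoint_family_on (holders ?D) (passes ?D)"
    by (auto simp: disjoint_family_on_def singleton_problem_def)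
  moreover have "\<sigma> \<notin> passes ?D \<longrightarrow> price ?D \<sigma> = 0" for \<sigma>
    by (cases \<sigma>) (auto simp: singleton_problem_def passes_def)
  moreover have "\<sigma> \<in> passes ?D \<longrightarrow> price ?D \<sigma> > 0" for \<sigma>
    using assms by (cases \<sigma>) auto
  moreover have "\<exists>i\<in>rows ?D \<sigma>. visits ?D \<sigma> i a = 1" if "a \<in> holders ?D \<sigma>" for \<sigma> a
    using that assms(6,7)[of a] by (auto split: if_splits)
  moreover have "{i} \<in> consortia ?D \<longrightarrow> price ?D (Individual i) = price ?D (Consortium {i})" for i
    by auto
  ultimately show ?thesis
    using assms(1-6) unfolding problems_def mem_Collect_eq
    by (intro conjI) (simp_all add: subset_iff, (meson assms(6) subsetD)?)
qed

lemma reduced_eq_singleton_problem: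
  fixes e :: "nat \<Rightarrow> 'm set"
  defines "back \<equiv> \<lambda>s \<iota> i. e (inv_into {1..s} \<iota> i)"
  shows "reduced \<iota> e D = (let s = card (consortia D) in
    singleton_problem (\<iota> ` {1..s})
      (\<lambda>i. price D (Consortium (back s \<iota> i))) (holders D General)
      (\<lambda>a. {i \<in> \<iota> ` {1..s}. \<exists>j\<in>back s \<iota> i. visits D General j a = 1})
      (price D General))"
  unfolding reduced_def singleton_problem_def Let_def back_def
  by (auto simp: fun_eq_iff split: pass.splits)

lemma reduced_in_problems:
  assumes D: "D \<in> problems0 MM NN" and inj: "inj_on \<iota> {1..}" and \<iota>: "\<iota> ` {1..} \<subseteq> MM"
    and e: "bij_betw e {1..card (consortia D)} (consortia D)"
  shows "reduced \<iota> e D \<in> problems MM NN"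
proof -
  let ?s = "card (consortia D)" let ?back = "\<lambda>i. e (inv_into {1..?s} \<iota> i)"
  have P: "D \<in> problems MM NN"
    using D by (simp add: problems0_def)
  have inj_s: "inj_on \<iota> {1..?s}"
    using inj by (rule inj_on_subset) auto
  have bck: "?back (\<iota> k) = e k" if "k \<in> {1..?s}" for k
    using inv_into_f_f[OF inj_s that] by simp
  have e_mem: "e k \<in> consortia D" if "k \<in> {1..?s}" for k
    using e that by (auto simp: bij_betw_def)
  have "consortia D \<noteq> {}"
    using problem_museums(2,4)[OF P] by (auto simp: partition_on_def)
  then have ne: "{1..?s} \<noteq> {}"
    using problem_museums(5)[OF P] by (simp add: card_gt_0_iff Suc_le_eq One_nat_def)
  \<comment> \<open>No column of the reduced problem is zero: the holder visits some museum, and the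
    consortium of this museum occurs in the enumeration.\<close>
  have vis: "{i \<in> \<iota> ` {1..?s}. \<exists>j\<in>?back i. visits D General j a = 1} \<noteq> {}"
    if a: "a \<in> holders D General" for a
  proof -
    obtain j where j: "visits D General j a = 1"
      using holder_visits[OF P a] by blast
    then obtain Q where "Q \<in> consortia D" "j \<in> Q"
      using consortium_of_mem[OF P visits_museum[OF P j]] by blast
    then obtain k where "k \<in> {1..?s}" "j \<in> e k"
      using e by (metis bij_betw_imp_surj_on imageE)
    then have "\<iota> k \<in> {i \<in> \<iota> ` {1..?s}. \<exists>j\<in>?back i. visits D General j a = 1}"
      using j bck by auto
    then show ?thesis by blast
  qed
  show ?thesis
    unfolding reduced_eq_singleton_problem Let_def
  proof (rule singleton_problem_in_problems)
    show "\<iota> ` {1..?s} \<subseteq> MM"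
      using \<iota> by auto
    show "price D (Consortium (?back i)) > 0" if "i \<in> \<iota> ` {1..?s}" for i
      using that bck e_mem problem_prices(1)[OF P] by auto
  qed (use ne vis problem_holders[OF P] problem_prices(1)[OF P] in auto)
qed

text \<open>The egalitarian factor is 1, since the consortium of a visited museum consists of that
  museum alone, and no passes other than general ones are held.\<close>

lemma proportional_egalitarian_singleton_problem:
  assumes D: "singleton_problem A p H K c \<in> problems MM NN" and "i \<in> A"
    and K: "\<And>a. a \<in> H \<Longrightarrow> K a \<subseteq> A"
  shows "proportional_egalitarian (singleton_problem A p H K c) i =
    (\<Sum>a | a \<in> H \<and> i \<in> K a. p i / sum p (K a) * c)"
proof -
  let ?D = "singleton_problem A p H K c"
  have co: "consortium_of ?D i = {i}"
    by (rule consortium_of_eq[OF D]) (use \<open>i \<in> A\<close> in auto)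
  have "visitors ?D General i = {a. a \<in> H \<and> i \<in> K a}"
    by (auto simp: visitors_def)
  moreover have "visitors ?D (Consortium {i}) i = {}"
    by (auto simp: visitors_def)
  moreover have "1 / real (card (visited_museums ?D a \<inter> {i})) *
      (price ?D (Consortium {i}) / (\<Sum>Q\<in>visited_consortia ?D a. price ?D (Consortium Q))) *
      price ?D General = p i / sum p (K a) * c" if "a \<in> H" "i \<in> K a" for a
  proof -
    have "visited_museums ?D a \<inter> {i} = {i}"
      using visited_museums_eq[OF D, of a General] that by auto
    moreover have "visited_consortia ?D a = (\<lambda>i. {i}) ` K a"
      using K[OF that(1)] that by (auto simp: visited_consortia_def)
    moreover have "(\<Sum>i\<in>K a. price ?D (Consortium {i})) = sum p (K a)"
      using K[OF that(1)] by (intro sum.cong) auto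
    ultimately show ?thesis
      using \<open>i \<in> A\<close> by (simp add: sum.reindex)
  qed
  ultimately show ?thesis
    unfolding proportional_egalitarian_def co by simp
qed

text \<open>After exchanging the sums over museums and holders, the equal parts that one holder
  gives to the visited museums of \<open>e k\<close> add up to the proportional share
  \<open>?w a\<close> of the consortium. A holder who visits no museum of \<open>e k\<close>
  contributes 0.\<close>

lemma proportional_egalitarian_consistent:
  assumes D: "D \<in> problems0 MM NN" and inj: "inj_on \<iota> {1..}" and \<iota>: "\<iota> ` {1..} \<subseteq> MM"
    and e: "bij_betw e {1..card (consortia D)} (consortia D)"
    and k: "k \<in> {1..card (consortia D)}"
  shows "(\<Sum>i\<in>e k. proportional_egalitarian D i) =
    proportional_egalitarian (reduced \<iota> e D) (\<iota> k)"
proof -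
  let ?s = "card (consortia D)" let ?back = "\<lambda>i. e (inv_into {1..?s} \<iota> i)"
  have P: "D \<in> problems MM NN" and D0: "\<And>\<sigma>. \<sigma> \<noteq> General \<Longrightarrow> holders D \<sigma> = {}"
    using D problem_holders(3)[of D] by (auto simp: problems0_def)
  have inj_s: "inj_on \<iota> {1..?s}"
    using inj by (rule inj_on_subset) auto
  have bck: "?back (\<iota> k) = e k" if "k \<in> {1..?s}" for k
    using inv_into_f_f[OF inj_s that] by simp
  have ek: "e k \<in> consortia D"
    using e k by (auto simp: bij_betw_def)
  let ?w = "\<lambda>a. price D (Consortium (e k)) /
    (\<Sum>Q\<in>visited_consortia D a. price D (Consortium Q)) * price D General"
  let ?V = "\<lambda>a. visited_museums D a \<inter> e k"
  have fin: "finite (holders D General)" "finite (e k)"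
    using problem_holders(1)[OF P] consortium_subset(3)[OF P ek] by auto
  have V: "i \<in> visited_museums D a \<longleftrightarrow> visits D General i a = 1" if "a \<in> holders D General" for i a
    using visited_museums_eq[OF P that] by auto
  have "(\<Sum>i\<in>e k. proportional_egalitarian D i) =
    (\<Sum>i\<in>e k. \<Sum>a | a \<in> holders D General \<and> visits D General i a = 1. 1 / real (card (?V a)) * ?w a)"
  proof (rule sum.cong[OF refl])
    fix i assume i: "i \<in> e k"
    have co: "consortium_of D i = e k"
      by (rule consortium_of_eq[OF P ek i])
    have "visitors D (Consortium (e k)) i = {}"
      using D0 by (auto simp: visitors_def)
    then show "proportional_egalitarian D i = (\<Sum>a | a \<in> holders D General \<and> visits D General i a = 1.
        1 / real (card (?V a)) * ?w a)"
      unfolding proportional_egalitarian_def co by (simp add: D0 visitors_def)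
  qed
  also have "\<dots> = (\<Sum>a\<in>holders D General. \<Sum>i | i \<in> e k \<and> visits D General i a = 1.
      1 / real (card (?V a)) * ?w a)"
    by (rule sum.swap_restrict) (use fin in auto)
  also have "\<dots> = (\<Sum>a\<in>holders D General. if ?V a = {} then 0 else ?w a)"
  proof (rule sum.cong[OF refl])
    fix a assume a: "a \<in> holders D General"
    have eq: "{i. i \<in> e k \<and> visits D General i a = 1} = ?V a"
      using V[OF a] by auto
    have "finite (?V a)"
      using fin by auto
    then show "(\<Sum>i | i \<in> e k \<and> visits D General i a = 1. 1 / real (card (?V a)) * ?w a) =
        (if ?V a = {} then 0 else ?w a)"
      unfolding eq by (cases "?V a = {}") auto
  qed
  also have "\<dots> = (\<Sum>a | a \<in> holders D General \<and> ?V a \<noteq> {}. ?w a)"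
    unfolding sum.inter_filter[OF fin(1)] by (rule sum.cong) auto
  also have "\<dots> = proportional_egalitarian (reduced \<iota> e D) (\<iota> k)"
  proof -
    let ?p = "\<lambda>i. price D (Consortium (?back i))"
    let ?K = "\<lambda>a. {i \<in> \<iota> ` {1..?s}. \<exists>j\<in>?back i. visits D General j a = 1}"
    have K: "\<iota> l \<in> ?K a \<longleftrightarrow> (\<exists>j\<in>e l. visits D General j a = 1)" if "l \<in> {1..?s}" for l a
      unfolding mem_Collect_eq bck[OF that] using imageI[OF that, of \<iota>] by blast
    have ne: "\<iota> k \<in> ?K a \<longleftrightarrow> ?V a \<noteq> {}" if "a \<in> holders D General" for a
      unfolding K[OF k] using V[OF that] by blast
    \<comment> \<open>\<open>?back\<close> maps the museums that \<open>a\<close> visits in the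
      reduced problem bijectively onto the consortia that \<open>a\<close> visits in
      \<open>D\<close>, preserving prices.\<close>
    have tot: "sum ?p (?K a) = (\<Sum>Q\<in>visited_consortia D a. price D (Consortium Q))" for a
    proof (rule sum.reindex_bij_betw)
      show "bij_betw ?back (?K a) (visited_consortia D a)"
        unfolding bij_betw_def
      proof
        have "inj_on ?back (\<iota> ` {1..?s})"
        proof (rule inj_onI, elim imageE)
          fix i i' k k' assume "?back i = ?back i'" and *: "i = \<iota> k" "k \<in> {1..?s}" "i' = \<iota> k'" "k' \<in> {1..?s}"
          then have "e k = e k'" using bck by metis
          then show "i = i'" using e * by (metis bij_betw_imp_inj_on inj_onD)
        qed
        then show "inj_on ?back (?K a)"
          by (rule inj_on_subset) auto
        have "Q \<in> ?back ` ?K a" if Q: "Q \<in> visited_consortia D a" for Q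
        proof -
          have "Q \<in> e ` {1..?s}"
            using Q e unfolding visited_consortia_def bij_betw_def by blast
          then obtain l where l: "Q = e l" "l \<in> {1..?s}" by (rule imageE)
          have \<iota>l: "\<iota> l \<in> ?K a"
            unfolding K[OF l(2)] using Q l(1) by (simp add: visited_consortia_def)
          show ?thesis
            by (rule image_eqI[OF _ \<iota>l]) (simp only: l(1) bck[OF l(2)])
        qed
        moreover have "?back i \<in> visited_consortia D a" if i: "i \<in> ?K a" for i
        proof -
          obtain l where l: "i = \<iota> l" "l \<in> {1..?s}"
            using i by (elim CollectE conjE imageE)
          have "\<exists>j\<in>e l. visits D General j a = 1"
            using i unfolding l(1) K[OF l(2)] .
          moreover have "e l \<in> consortia D"
            using e l(2) by (auto simp: bij_betw_def)
          ultimately show ?thesis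
            unfolding l(1) bck[OF l(2)] by (simp add: visited_consortia_def)
        qed
        ultimately show "?back ` ?K a = visited_consortia D a" by blast
      qed
    qed
    show ?thesis
      unfolding reduced_eq_singleton_problem Let_def
    proof (subst proportional_egalitarian_singleton_problem
          [OF reduced_in_problems[OF D inj \<iota> e, unfolded reduced_eq_singleton_problem Let_def]])
      show "\<iota> k \<in> \<iota> ` {1..?s}" using k by (rule imageI)
      show "?K a \<subseteq> \<iota> ` {1..?s}" for a by (rule Collect_restrict)
      show "(\<Sum>a | a \<in> holders D General \<and> ?V a \<noteq> {}. ?w a) =
        (\<Sum>a | a \<in> holders D General \<and> \<iota> k \<in> ?K a.
          price D (Consortium (?back (\<iota> k))) / sum ?p (?K a) * price D General)"
        unfolding tot bck[OF k] by (intro sum.cong) (use ne in blast)+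
    qed
  qed
  finally show ?thesis .
qed

section \<open>Problems with a single holder\<close>

lemma single_holder_revenue:
  assumes D: "D \<in> problems MM NN" and h: "holders D = (\<lambda>_. {})(\<sigma> := {a})"
  shows "revenue D = price D \<sigma>"
proof -
  have fin: "finite (museums D)" "finite (consortia D)"
    using problem_museums[OF D] by auto
  have c: "real (card (holders D \<tau>)) * price D \<tau> = (if \<tau> = \<sigma> then price D \<sigma> else 0)" for \<tau>
    by (simp add: h)
  have \<sigma>: "\<sigma> \<in> passes D"
    using problem_holders(3)[OF D, of a \<sigma>] by (simp add: h)
  show ?thesis
    using \<sigma> fin unfolding revenue_def c by (cases \<sigma>) auto
qed

text \<open>\<open>R\<close> is arbitrary apart from dummy, so that the lemma serves the given rule
  and \<open>proportional_egalitarian\<close> alike.\<close>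

lemma single_holder_unvisited:
  assumes D: "D \<in> problems MM NN" and h: "holders D = (\<lambda>_. {})(\<sigma> := {a})"
    and "dummy MM NN R" "i \<in> museums D" "i \<notin> visited_museums D a"
  shows "R D i = 0"
proof -
  have "visits D \<tau> i b = 0" if "b \<in> holders D \<tau>" for \<tau> b
  proof -
    have "\<tau> = \<sigma>" "b = a"
      using that by (auto simp: h split: if_splits)
    then show ?thesis
      using assms(5) visits_01[OF D, of \<tau> i b] visited_museums_eq[OF D that] by auto
  qed
  then show ?thesis
    using assms(3)[unfolded dummy_def, rule_format, OF D assms(4)] by simp
qed

lemma visited_museums_subset: "visited_museums D a \<subseteq> museums D"
  by (auto simp: visited_museums_def)

text \<open>The revenue is the price of the only pass sold, and dummy removes the unvisited museums
  from the sum.\<close>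

lemma single_holder_sum:
  assumes D: "D \<in> problems MM NN" and h: "holders D = (\<lambda>_. {})(\<sigma> := {a})"
    and R: "is_rule MM NN R" "dummy MM NN R"
  shows "(\<Sum>i\<in>visited_museums D a. R D i) = price D \<sigma>"
proof -
  have "(\<Sum>i\<in>visited_museums D a. R D i) = (\<Sum>i\<in>museums D. R D i)"
    using problem_museums(1)[OF D] visited_museums_subset[of D a] single_holder_unvisited[OF D h R(2)]
    by (intro sum.mono_neutral_left) auto
  also have "\<dots> = price D \<sigma>"
    using R(1) D single_holder_revenue[OF D h] unfolding is_rule_def by simp
  finally show ?thesis .
qed

lemma dummy_proportional_egalitarian: "dummy MM NN proportional_egalitarian"
  unfolding dummy_def by (intro ballI impI) (rule proportional_egalitarian_dummy)

lemma symmetry_proportional_egalitarian: "symmetry_within_consortia MM NN proportional_egalitarian"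
  unfolding symmetry_within_consortia_def
  by (intro ballI impI, elim conjE) (rule proportional_egalitarian_symmetry)

text \<open>With no individual pass sold, the third condition of symmetry reads 0 = 0. In the only
  column present, both museums have entry 1.\<close>

lemma single_holder_symmetric:
  assumes D: "D \<in> problems MM NN" and h: "holders D = (\<lambda>_. {})(\<sigma> := {a})"
    and \<sigma>: "\<And>k. \<sigma> \<noteq> Individual k" and R: "symmetry_within_consortia MM NN R"
    and co: "consortium_of D i = consortium_of D j"
    and ij: "i \<in> visited_museums D a" "j \<in> visited_museums D a"
  shows "R D i = R D j"
proof -
  have "visits D \<tau> i b = visits D \<tau> j b" if "b \<in> holders D \<tau>" for \<tau> b
  proof -
    have "b = a"
      using that by (auto simp: h split: if_splits)
    then show ?thesis
      using ij visited_museums_eq[OF D that] by auto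
  qed
  moreover have "holders D (Individual k) = {}" for k
    using \<sigma>[of k] by (simp add: h)
  moreover have "i \<in> museums D" "j \<in> museums D"
    using ij visited_museums_subset[of D a] by auto
  ultimately show ?thesis
    using R[unfolded symmetry_within_consortia_def, rule_format, OF D, of i j] co by simp
qed

text \<open>The pass has the single row \<open>j\<close>, so \<open>j\<close> is the only visited
  museum and receives the whole revenue.\<close>

lemma individual_holder_share:
  assumes D: "D \<in> problems MM NN" and h: "holders D = (\<lambda>_. {})(Individual j := {a})"
    and R: "is_rule MM NN R" "dummy MM NN R" and i: "i \<in> museums D"
  shows "R D i = proportional_egalitarian D i"
proof (cases "i \<in> visited_museums D a")
  case True
  have a: "a \<in> holders D (Individual j)"
    by (simp add: h)
  have sub: "visited_museums D a \<subseteq> {j}"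
    using visits_1D(2)[OF D, of "Individual j" _ a] unfolding visited_museums_eq[OF D a] by auto
  then have "visited_museums D a = {j}" "i = j"
    using True by auto
  then have "R D i = price D (Individual i)"
    using single_holder_sum[OF D h R] by simp
  moreover have "proportional_egalitarian D i = price D (Individual i)"
    by (simp add: proportional_egalitarian_def visitors_def h \<open>i = j\<close>)
  ultimately show ?thesis by simp
next
  case False
  then show ?thesis
    using single_holder_unvisited[OF D h _ i False] R(2) dummy_proportional_egalitarian by metis
qed

text \<open>All visited museums lie in \<open>Q\<close>. By symmetry their shares are equal, and
  they add up to the price of the pass.\<close>

lemma consortium_holder_share:
  assumes D: "D \<in> problems MM NN" and h: "holders D = (\<lambda>_. {})(Consortium Q := {a})"
    and R: "is_rule MM NN R" "dummy MM NN R" "symmetry_within_consortia MM NN R"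
    and i: "i \<in> museums D"
  shows "R D i = proportional_egalitarian D i"
proof (cases "i \<in> visited_museums D a")
  case True
  have a: "a \<in> holders D (Consortium Q)"
    by (simp add: h)
  have Q: "Q \<in> consortia D"
    using problem_holders(3)[OF D a] by simp
  have co: "consortium_of D j = Q" if "j \<in> visited_museums D a" for j
  proof (rule consortium_of_eq[OF D Q])
    show "j \<in> Q"
      using visits_1D(2)[OF D, of "Consortium Q" j a] that unfolding visited_museums_eq[OF D a] by auto
  qed
  have "R D j = R D i" if "j \<in> visited_museums D a" for j
    using single_holder_symmetric[OF D h _ R(3), of j i] co[OF that] co[OF True] that True by simp
  then have "real (card (visited_museums D a)) * R D i = price D (Consortium Q)"
    using single_holder_sum[OF D h R(1,2)] by simp
  moreover have n: "card (visited_museums D a) > 0"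
    using True visited_museums_finite[OF D] card_gt_0_iff by blast
  moreover have "visitors D (Consortium Q) i = {a}"
    using True visited_museums_eq[OF D a] by (auto simp: visitors_def h)
  then have "proportional_egalitarian D i =
      1 / real (card (visited_museums D a)) * price D (Consortium Q)"
    unfolding proportional_egalitarian_def co[OF True] by (simp add: visitors_def[of D General] h)
  then have "real (card (visited_museums D a)) * proportional_egalitarian D i = price D (Consortium Q)"
    using n by simp
  ultimately have "real (card (visited_museums D a)) * R D i =
      real (card (visited_museums D a)) * proportional_egalitarian D i"
    by simp
  then show ?thesis
    using n by simp
next
  case False
  then show ?thesis
    using single_holder_unvisited[OF D h _ i False] R(2) dummy_proportional_egalitarian by metis
qed

section \<open>Proportional shares for one general-pass holder and singleton consortia\<close>

lemma singleton_problemD: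
  assumes "singleton_problem A p H K c \<in> problems MM NN"
  shows "finite A" "A \<noteq> {}" "A \<subseteq> MM" "finite H" "H \<subseteq> NN"
    "a \<in> H \<Longrightarrow> K a \<subseteq> A" "a \<in> H \<Longrightarrow> K a \<noteq> {}" "i \<in> A \<Longrightarrow> p i > 0" "c > 0"
proof -
  note D = assms
  show "finite A" "A \<noteq> {}" "A \<subseteq> MM"
    using problem_museums[OF D] by auto
  show "finite H" "H \<subseteq> NN"
    using problem_holders(1,2)[OF D, of General] by auto
  show "K a \<subseteq> A" if "a \<in> H"
    using visits_museum[OF D, of General _ a] that by auto
  show "K a \<noteq> {}" if "a \<in> H"
    using holder_visits[OF D, of a General] that by (auto split: if_splits)
  show "p i > 0" if "i \<in> A"
    using problem_prices(1)[OF D, of "Individual i"] that by simp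
  show "c > 0"
    using problem_prices(1)[OF D, of General] by simp
qed

text \<open>Exchanging two consortia in the enumeration does not change the reduced problem.\<close>

lemma singleton_problem_anonymous:
  assumes D: "singleton_problem A p {a} (\<lambda>_. K) c \<in> problems MM NN"
    and R: "consortia_consistency MM NN \<iota> R"
    and u: "u \<in> K" and v: "v \<in> K" and uv: "p u = p v"
  shows "R (singleton_problem A p {a} (\<lambda>_. K) c) u = R (singleton_problem A p {a} (\<lambda>_. K) c) v"
proof -
  let ?D = "singleton_problem A p {a} (\<lambda>_. K) c" and ?s = "card ((\<lambda>i. {i}) ` A)"
  have D0: "?D \<in> problems0 MM NN"
    using D by (auto simp: problems0_def)
  have A: "u \<in> A" "v \<in> A"
    using singleton_problemD(6)[OF D] u v by auto
  have "finite ((\<lambda>i. {i}) ` A)"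
    using singleton_problemD(1)[OF D] by simp
  then obtain e where e: "bij_betw e {1..?s} ((\<lambda>i. {i}) ` A)"
    using ex_bij_betw_nat_finite_1 by blast
  obtain k where k: "k \<in> {1..?s}" "e k = {u}"
    using e A(1) by (metis (no_types, lifting) bij_betw_imp_surj_on image_iff)
  obtain l where l: "l \<in> {1..?s}" "e l = {v}"
    using e A(2) by (metis (no_types, lifting) bij_betw_imp_surj_on image_iff)
  define \<tau> where "\<tau> = (\<lambda>j. if j = k then l else if j = l then k else j)"
  have \<tau>\<tau>: "\<tau> (\<tau> j) = j" for j
    by (simp add: \<tau>_def)
  have \<tau>_range: "\<tau> ` {1..?s} \<subseteq> {1..?s}"
    using k(1) l(1) unfolding \<tau>_def by auto
  have "bij_betw \<tau> {1..?s} {1..?s}"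
    by (rule bij_betw_byWitness[where f' = \<tau>]) (use \<tau>\<tau> \<tau>_range in auto)
  then have e': "bij_betw (\<lambda>j. e (\<tau> j)) {1..?s} ((\<lambda>i. {i}) ` A)"
    using bij_betw_trans[OF _ e] by (simp add: o_def)
  \<comment> \<open>The museums \<open>u\<close> and \<open>v\<close> have the same price and are
    both visited by \<open>a\<close>, so each position looks the same in both enumerations.\<close>
  have "price ?D (Consortium (e (\<tau> j))) = price ?D (Consortium (e j))" for j
    using k(2) l(2) A uv by (simp add: \<tau>_def)
  moreover have "(\<exists>i\<in>e (\<tau> j). visits ?D General i b = 1) \<longleftrightarrow> (\<exists>i\<in>e j. visits ?D General i b = 1)" for j b
    using k(2) l(2) u v by (simp add: \<tau>_def)
  ultimately have red: "reduced \<iota> (\<lambda>j. e (\<tau> j)) ?D = reduced \<iota> e ?D"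
    unfolding reduced_eq_singleton_problem by simp
  \<comment> \<open>Position \<open>k\<close> stands for \<open>{u}\<close> under \<open>e\<close>
    and for \<open>{v}\<close> under the exchanged enumeration. Both shares equal the share of the
    one museum \<open>\<iota> k\<close> of the common reduced problem.\<close>
  have "(\<Sum>i\<in>e k. R ?D i) = R (reduced \<iota> e ?D) (\<iota> k)"
    using R[unfolded consortia_consistency_def, rule_format, OF D0, of e k] e k(1) by simp
  moreover have "(\<Sum>i\<in>e (\<tau> k). R ?D i) = R (reduced \<iota> (\<lambda>j. e (\<tau> j)) ?D) (\<iota> k)"
    using R[unfolded consortia_consistency_def, rule_format, OF D0, of "\<lambda>j. e (\<tau> j)" k] e' k(1) by simp
  ultimately show ?thesis
    unfolding red using k(2) l(2) by (simp add: \<tau>_def)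
qed

lemma single_visit_sum:
  assumes D: "singleton_problem A p {a} (\<lambda>_. K) c \<in> problems MM NN"
    and R: "is_rule MM NN R"
  shows "(\<Sum>i\<in>A. R (singleton_problem A p {a} (\<lambda>_. K) c) i) = c"
proof -
  let ?D = "singleton_problem A p {a} (\<lambda>_. K) c"
  have "holders ?D = (\<lambda>_. {})(General := {a})"
    by auto
  then show ?thesis
    using R D single_holder_revenue[OF D] unfolding is_rule_def by force
qed

lemma single_visit_unvisited:
  assumes D: "singleton_problem A p {a} (\<lambda>_. K) c \<in> problems MM NN"
    and R: "dummy MM NN R" and "i \<in> A" "i \<notin> K"
  shows "R (singleton_problem A p {a} (\<lambda>_. K) c) i = 0"
proof (rule single_holder_unvisited[OF D _ R])
  show "i \<notin> visited_museums (singleton_problem A p {a} (\<lambda>_. K) c) a"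
    using visited_museums_eq[OF D, of a General] \<open>i \<notin> K\<close> by simp
qed (use \<open>i \<in> A\<close> in auto)

text \<open>Splitting-proofness fixes the shares on \<open>A - {x}\<close>. Both problems distribute
  the same amount \<open>c\<close>, so what \<open>x\<close> received passes to its successors
  \<open>B\<close> as a whole. The function \<open>p\<close> already carries the prices of
  \<open>B\<close>, which the original problem does not read.\<close>

lemma singleton_problem_split:
  assumes D: "singleton_problem A p {a} (\<lambda>_. K) c \<in> problems MM NN"
    and R: "is_rule MM NN R" "splitting_proofness MM NN R"
    and x: "x \<in> K" and B: "finite B" "B \<noteq> {}" "B \<subseteq> MM - A" "\<And>i. i \<in> B \<Longrightarrow> p i > 0" "sum p B = p x"
  defines "D' \<equiv> singleton_problem (A - {x} \<union> B) p {a} (\<lambda>_. K - {x} \<union> B) c"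
  shows "D' \<in> problems MM NN"
    and "i \<in> A - {x} \<Longrightarrow> R D' i = R (singleton_problem A p {a} (\<lambda>_. K) c) i"
    and "(\<Sum>i\<in>B. R D' i) = R (singleton_problem A p {a} (\<lambda>_. K) c) x"
proof -
  let ?D = "singleton_problem A p {a} (\<lambda>_. K) c"
  note A = singleton_problemD[OF D]
  have K: "K \<subseteq> A" "x \<in> A" "a \<in> NN"
    using A(5) A(6)[of a] x by auto
  show D': "D' \<in> problems MM NN"
    unfolding D'_def by (rule singleton_problem_in_problems) (use A(1-5,8,9) B K in auto)
  obtain f where f: "bij_betw f {1..card B} B"
    using ex_bij_betw_nat_finite_1[OF B(1)] by blast
  have fB: "f l \<in> B" if "l \<in> {1..card B}" for l
    using f that by (auto simp: bij_betw_def)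
  have fim: "f ` {1..card B} = B"
    using f by (simp add: bij_betw_def)
  have inj: "inj_on f {1..card B}"
    using f by (simp add: bij_betw_def)
  have sumf: "(\<Sum>l\<in>{1..card B}. p (f l)) = p x"
    using sum.reindex_bij_betw[OF f, of p] B(5) by simp
  have sumC: "(\<Sum>l\<in>{1..card B}. price D' (Consortium {f l})) = p x"
    "(\<Sum>l\<in>{1..card B}. price D' (Individual (f l))) = p x"
  proof -
    have "price D' (Consortium {f l}) = p (f l)" "price D' (Individual (f l)) = p (f l)"
      if "l \<in> {1..card B}" for l
      using fB[OF that] by (simp_all add: D'_def)
    then show "(\<Sum>l\<in>{1..card B}. price D' (Consortium {f l})) = p x"
      "(\<Sum>l\<in>{1..card B}. price D' (Individual (f l))) = p x"
      using sumf by simp_all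
  qed
  have old: "price D' (Consortium {i}) = p i" "price D' (Individual i) = p i"
    "price ?D (Consortium {i}) = p i" "price ?D (Individual i) = p i" if "i \<in> A - {x}" for i
    using that by (simp_all add: D'_def)
  \<comment> \<open>The split consortium has one museum, so the successor map depends on the copy
    \<open>l\<close> only, and \<open>f\<close> enumerates the successors.\<close>
  have "split_of MM ?D {x} (card B) (\<lambda>l h. f l) D'"
    unfolding split_of_def
  proof (intro conjI)
    show "inj_on (\<lambda>(l, h). f l) ({1..card B} \<times> {x})"
      by (rule inj_onI) (auto dest: inj_onD[OF inj])
    show "\<forall>l\<in>{1..card B}. \<forall>h\<in>{x}. f l \<in> MM - (museums ?D - {x})"
      using fB B(3) by fastforce
    show "museums D' = museums ?D - {x} \<union> (\<Union>l\<in>{1..card B}. (\<lambda>h. f l) ` {x})"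
      using fim by (auto simp: D'_def)
    show "consortia D' = consortia ?D - {{x}} \<union> (\<lambda>l. (\<lambda>h. f l) ` {x}) ` {1..card B}"
      using fim by (auto simp: D'_def)
    show "\<forall>l\<in>{1..card B}. \<forall>h\<in>{x}. \<forall>b\<in>holders ?D General.
        visits D' General (f l) b = visits ?D General h b"
      using fB x by (simp add: D'_def)
    show "\<forall>i\<in>museums ?D - {x}. \<forall>b\<in>holders ?D General.
        visits D' General i b = visits ?D General i b"
      using B(3) by (auto simp: D'_def)
    \<comment> \<open>Only general passes are held, so the holder sets to be copied are
      empty.\<close>
    show "\<forall>l\<in>{1..card B}. \<exists>\<beta>.
        bij_betw \<beta> (holders ?D (Consortium {x})) (holders D' (Consortium ((\<lambda>h. f l) ` {x}))) \<and>
        (\<forall>h\<in>{x}. \<forall>b\<in>holders ?D (Consortium {x}).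
           visits D' (Consortium ((\<lambda>h. f l) ` {x})) (f l) (\<beta> b) = visits ?D (Consortium {x}) h b)"
      by (simp add: D'_def bij_betw_def)
    show "\<forall>l\<in>{1..card B}. \<forall>h\<in>{x}. \<exists>\<beta>.
        bij_betw \<beta> (holders ?D (Individual h)) (holders D' (Individual (f l))) \<and>
        (\<forall>b\<in>holders ?D (Individual h).
           visits D' (Individual (f l)) (f l) (\<beta> b) = visits ?D (Individual h) h b)"
      by (simp add: D'_def bij_betw_def)
    show "(\<Sum>l\<in>{1..card B}. price D' (Consortium ((\<lambda>h. f l) ` {x}))) = price ?D (Consortium {x})"
      "\<forall>h\<in>{x}. (\<Sum>l\<in>{1..card B}. price D' (Individual (f l))) = price ?D (Individual h)"
      using sumC K(2) by simp_all
    show "\<forall>\<sigma>\<in>Individual ` (museums ?D - {x}) \<union> Consortium ` (consortia ?D - {{x}}).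
        holders D' \<sigma> = holders ?D \<sigma> \<and> price D' \<sigma> = price ?D \<sigma> \<and>
        (\<forall>i\<in>rows ?D \<sigma>. \<forall>b\<in>holders ?D \<sigma>. visits D' \<sigma> i b = visits ?D \<sigma> i b)"
    proof
      fix \<sigma> assume "\<sigma> \<in> Individual ` (museums ?D - {x}) \<union> Consortium ` (consortia ?D - {{x}})"
      then obtain i where i: "i \<in> A - {x}" "\<sigma> = Individual i \<or> \<sigma> = Consortium {i}"
        by auto
      then show "holders D' \<sigma> = holders ?D \<sigma> \<and> price D' \<sigma> = price ?D \<sigma> \<and>
          (\<forall>i\<in>rows ?D \<sigma>. \<forall>b\<in>holders ?D \<sigma>. visits D' \<sigma> i b = visits ?D \<sigma> i b)"
        using old[OF i(1)] by (elim disjE; simp; simp add: D'_def)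
    qed
  qed (use K(2) in \<open>simp_all add: D'_def\<close>)
  then have "(\<Sum>j\<in>{i}. R ?D j) = (\<Sum>j\<in>{i}. R D' j)" if "i \<in> A - {x}" for i
    using R(2)[unfolded splitting_proofness_def, rule_format, OF D D', of "{x}" _ _ "{i}"] that by auto
  then show oth: "R D' i = R ?D i" if "i \<in> A - {x}" for i
    using that by simp
  have "sum (R D') (A - {x}) + sum (R D') B = c"
    using single_visit_sum[OF D'[unfolded D'_def] R(1), folded D'_def] A(1) B(1,3)
      sum.union_disjoint[of "A - {x}" B "R D'"] by force
  moreover have "sum (R D') (A - {x}) = sum (R ?D) (A - {x})"
    using oth by (intro sum.cong) auto
  ultimately show "(\<Sum>i\<in>B. R D' i) = R ?D x"
    using single_visit_sum[OF D R(1)] sum.remove[OF A(1) K(2), of "R ?D"] by simp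
qed

text \<open>
  Splitting \<open>x\<close> into \<open>n\<close> parts of equal price, and \<open>m\<close> parts of this price off \<open>y\<close>, produces
  \<open>n + m\<close> museums with equal shares.
\<close>

lemma singleton_problem_share_le:
  assumes D: "singleton_problem A p {a} (\<lambda>_. K) c \<in> problems MM NN"
    and MM: "infinite MM"
    and R: "is_rule MM NN R" "splitting_proofness MM NN R" "consortia_consistency MM NN \<iota> R"
    and xy: "x \<in> K" "y \<in> K" "x \<noteq> y" and n: "0 < n" "real m * p x < real n * p y"
  shows "real m * R (singleton_problem A p {a} (\<lambda>_. K) c) x
    \<le> real n * R (singleton_problem A p {a} (\<lambda>_. K) c) y"
proof -
  note A = singleton_problemD[OF D]
  have K: "K \<subseteq> A" "x \<in> A" "y \<in> A"
    using A(6)[of a] xy by auto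
  have "infinite (MM - A)"
    using MM A(1) by simp
  then obtain B1 where B1: "finite B1" "card B1 = n" "B1 \<subseteq> MM - A"
    using infinite_arbitrarily_large by blast
  have "infinite (MM - A - B1)"
    using \<open>infinite (MM - A)\<close> B1(1) by simp
  then obtain B2 where B2: "finite B2" "card B2 = m" "B2 \<subseteq> MM - A - B1"
    using infinite_arbitrarily_large by blast
  have "infinite (MM - A - B1 - B2)"
    using \<open>infinite (MM - A - B1)\<close> B2(1) by simp
  \<comment> \<open>\<open>z\<close> takes what is left of \<open>y\<close> after \<open>m\<close>
    parts of price \<open>\<epsilon>\<close> have been cut off. The strict inequality in the
    hypothesis makes its price positive.\<close>
  then obtain z where z: "z \<in> MM - A - B1 - B2"
    using infinite_imp_nonempty by blast
  have B1_ne: "B1 \<noteq> {}"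
    using B1(2) n(1) by auto
  define \<epsilon> where "\<epsilon> = p x / real n"
  have \<epsilon>: "\<epsilon> > 0" "real n * \<epsilon> = p x" "real m * \<epsilon> < p y"
    using A(8)[OF K(2)] n by (auto simp: \<epsilon>_def field_simps)
  \<comment> \<open>One price function for all three problems; it agrees with \<open>p\<close> on
    \<open>A\<close>, so the original problem can be written with \<open>q\<close> as well.\<close>
  define q where "q = (\<lambda>i. if i \<in> A then p i else if i = z then p y - real m * \<epsilon> else \<epsilon>)"
  have qA: "q i = p i" if "i \<in> A" for i
    using that by (simp add: q_def)
  have q1: "q i = \<epsilon>" if "i \<in> B1 \<union> B2" for i
    using that B1(3) B2(3) z by (auto simp: q_def)
  have qz: "q z = p y - real m * \<epsilon>"
    using z by (simp add: q_def)
  let ?D = "singleton_problem A p {a} (\<lambda>_. K) c"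
  let ?D1 = "singleton_problem (A - {x} \<union> B1) q {a} (\<lambda>_. K - {x} \<union> B1) c"
  let ?D2 = "singleton_problem (A - {x} \<union> B1 - {y} \<union> insert z B2) q {a}
    (\<lambda>_. K - {x} \<union> B1 - {y} \<union> insert z B2) c"
  have Dq: "?D = singleton_problem A q {a} (\<lambda>_. K) c"
    by (rule singleton_problem_cong) (auto simp: qA)
  have sum1: "sum q B1 = q x"
    using q1 B1(2) \<epsilon>(2) qA[OF K(2)] by simp
  note S1 = singleton_problem_split[OF D[unfolded Dq] R(1,2) xy(1) B1(1) B1_ne B1(3) _ sum1,
      folded Dq]
  have q1_pos: "q i > 0" if "i \<in> B1 \<union> B2" for i
    using q1[OF that] \<epsilon>(1) by simp
  have D1: "?D1 \<in> problems MM NN"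
    and y1: "R ?D1 y = R ?D y" and x1: "(\<Sum>i\<in>B1. R ?D1 i) = R ?D x"
    using S1 q1_pos K(3) xy(3) by auto
  have z': "z \<notin> B2" "z \<notin> B1" "z \<notin> A"
    using z by auto
  have "sum q (insert z B2) = q z + real m * \<epsilon>"
    using B2(1,2) z' q1 by simp
  then have sum2: "sum q (insert z B2) = q y"
    using qz qA[OF K(3)] by simp
  have fin2: "finite (insert z B2)" and ne2: "insert z B2 \<noteq> {}"
    and sub2: "insert z B2 \<subseteq> MM - (A - {x} \<union> B1)" and y2: "y \<in> K - {x} \<union> B1"
    using B2(1,3) z xy by auto
  have pos2: "q i > 0" if "i \<in> insert z B2" for i
    using that q1_pos[of i] qz \<epsilon>(3) by auto
  note S2 = singleton_problem_split[OF D1 R(1,2) y2 fin2 ne2 sub2 pos2 sum2]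
  have D2: "?D2 \<in> problems MM NN"
    by (rule S2(1))
  have B1y: "i \<in> A - {x} \<union> B1 - {y}" if "i \<in> B1" for i
    using that B1(3) K(3) by auto
  have x2: "(\<Sum>i\<in>B1. R ?D2 i) = R ?D x"
    unfolding x1[symmetric] by (intro sum.cong refl S2(2) B1y)
  have y2: "(\<Sum>i\<in>insert z B2. R ?D2 i) = R ?D y"
    using S2(3) y1 by simp
  obtain u where u: "u \<in> B1"
    using B1_ne by blast
  have anon: "R ?D2 i = R ?D2 u" if "i \<in> B1 \<union> B2" for i
  proof (rule singleton_problem_anonymous[OF D2 R(3)])
    show "i \<in> K - {x} \<union> B1 - {y} \<union> insert z B2" "u \<in> K - {x} \<union> B1 - {y} \<union> insert z B2"
      using that u B1y by auto
    show "q i = q u"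
      using q1 that u by simp
  qed
  have "real n * R ?D2 u = R ?D x"
    using x2 anon B1(2) by simp
  moreover have "R ?D2 z + real m * R ?D2 u = R ?D y"
    using y2 anon B2(1,2) z' by simp
  \<comment> \<open>The share of the remainder is unknown; its nonnegativity turns the count of
    equal parts into an inequality.\<close>
  moreover have "R ?D2 z \<ge> 0"
    using R(1) D2 unfolding is_rule_def by simp
  ultimately have *: "R ?D x = real n * R ?D2 u" "real m * R ?D2 u \<le> R ?D y"
    by auto
  have "real m * R ?D x = real n * (real m * R ?D2 u)"
    unfolding *(1) by (rule mult.left_commute)
  also have "\<dots> \<le> real n * R ?D y"
    using *(2) by (rule mult_left_mono) simp
  finally show ?thesis .
qed

text \<open>If two shares were not in the ratio of the prices, a rational strictly between the two
  ratios would contradict \<open>singleton_problem_share_le\<close>. Hence the shares on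
  \<open>K\<close> are proportional to the prices. They add up to \<open>c\<close>, because museums
  outside \<open>K\<close> receive 0.\<close>

lemma singleton_problem_share:
  assumes D: "singleton_problem A p {a} (\<lambda>_. K) c \<in> problems MM NN"
    and MM: "infinite MM"
    and R: "is_rule MM NN R" "dummy MM NN R" "splitting_proofness MM NN R"
      "consortia_consistency MM NN \<iota> R"
    and x: "x \<in> K"
  shows "R (singleton_problem A p {a} (\<lambda>_. K) c) x = p x / sum p K * c"
proof -
  let ?R = "R (singleton_problem A p {a} (\<lambda>_. K) c)"
  note A = singleton_problemD[OF D]
  have K: "K \<subseteq> A" "finite K"
    using A(6)[of a] A(1) finite_subset by auto
  have p: "p i > 0" if "i \<in> K" for i
    using A(8) K that by auto
  have nonneg: "?R i \<ge> 0" if "i \<in> K" for i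
    using R(1) D K that unfolding is_rule_def by auto
  have le: "?R i * p j \<le> ?R j * p i" if ij: "i \<in> K" "j \<in> K" "i \<noteq> j" for i j
  proof (rule ccontr)
    assume less: "\<not> ?R i * p j \<le> ?R j * p i"
    have "?R i \<noteq> 0"
      using less nonneg[OF ij(2)] p[OF ij(1)] by auto
    then have Ri: "?R i > 0"
      using nonneg[OF ij(1)] by simp
    then have "?R j / ?R i < p j / p i"
      using less p[OF ij(1)] by (simp add: field_simps)
    \<comment> \<open>Both inequalities must be strict: with \<open>r = m / n\<close>, the upper one
      is the hypothesis of \<open>singleton_problem_share_le\<close>, and the lower one refutes its
      conclusion.\<close>
    then obtain r where r: "r \<in> \<rat>" "?R j / ?R i < r" "r < p j / p i"
      using Rats_dense_in_real by blast
    obtain m n :: nat where mn: "n \<noteq> 0" "\<bar>r\<bar> = real m / real n"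
      using Rats_abs_nat_div_natE[OF r(1)] by metis
    \<comment> \<open>This makes \<open>r\<close> positive, so the fraction obtained for its
      absolute value represents \<open>r\<close> itself.\<close>
    have "0 \<le> ?R j / ?R i"
      using nonneg ij by simp
    then have "r = real m / real n"
      using mn r(2) by linarith
    then have m: "real m = real n * r"
      using mn(1) by simp
    have "r * p i < p j" "?R j < r * ?R i"
      using r(2,3) Ri p[OF ij(1)] by (simp_all add: field_simps)
    then have "real n * (r * p i) < real n * p j" "real n * ?R j < real n * (r * ?R i)"
      using mn(1) by simp_all
    then have "real m * p i < real n * p j" "real n * ?R j < real m * ?R i"
      unfolding m by (simp_all only: mult.assoc)
    then show False
      using singleton_problem_share_le[OF D MM R(1,3,4) ij, of n m] mn(1) by simp
  qed
  have eq: "?R x * p j = ?R j * p x" if "j \<in> K" for j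
    using le[OF x that] le[OF that x] by (cases "x = j") auto
  have "sum ?R K = sum ?R A"
    using single_visit_unvisited[OF D R(2)] K(1) A(1) by (intro sum.mono_neutral_left) auto
  then have "sum ?R K = c"
    using single_visit_sum[OF D R(1)] by simp
  moreover have "?R x * sum p K = sum ?R K * p x"
    using eq by (simp add: sum_distrib_left sum_distrib_right)
  moreover have "sum p K > 0"
    using sum_pos[OF K(2)] p x by blast
  ultimately show ?thesis
    by (simp add: field_simps)
qed

section \<open>A general-pass holder and arbitrary consortia\<close>

text \<open>Consistency of both functions carries agreement on the reduced problem back to the total
  of the consortium of \<open>i\<close>. Dummy and symmetry then make either function spread this
  total evenly over the visited museums of that consortium.\<close>

lemma general_holder_share:
  assumes D: "D \<in> problems MM NN" and h: "holders D = (\<lambda>_. {})(General := {a})"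
    and MM: "infinite MM" and \<iota>: "inj_on \<iota> {1..}" "\<iota> ` {1..} \<subseteq> MM"
    and R: "is_rule MM NN R" "dummy MM NN R" "symmetry_within_consortia MM NN R"
      "splitting_proofness MM NN R" "consortia_consistency MM NN \<iota> R"
    and i: "i \<in> museums D"
  shows "R D i = proportional_egalitarian D i"
proof (cases "i \<in> visited_museums D a")
  case True
  let ?Q = "consortium_of D i" and ?s = "card (consortia D)"
  have Q: "?Q \<in> consortia D" "i \<in> ?Q"
    using consortium_of_mem[OF D i] by auto
  have D0: "D \<in> problems0 MM NN"
    using D by (simp add: problems0_def h)
  obtain e where e: "bij_betw e {1..?s} (consortia D)"
    using ex_bij_betw_nat_finite_1[OF problem_museums(5)[OF D]] by blast
  obtain k where k: "k \<in> {1..?s}" "e k = ?Q"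
    using e Q(1) by (metis bij_betw_imp_surj_on imageE)
  define A where "A = \<iota> ` {1..?s}"
  define p where "p = (\<lambda>i. price D (Consortium (e (inv_into {1..?s} \<iota> i))))"
  define K where "K = {i \<in> A. \<exists>j\<in>e (inv_into {1..?s} \<iota> i). visits D General j a = 1}"
  have red: "reduced \<iota> e D = singleton_problem A p {a} (\<lambda>_. K) (price D General)"
    unfolding reduced_eq_singleton_problem Let_def
    by (rule singleton_problem_cong) (simp_all add: h A_def p_def K_def)
  have P: "singleton_problem A p {a} (\<lambda>_. K) (price D General) \<in> problems MM NN"
    using reduced_in_problems[OF D0 \<iota> e] unfolding red .
  have kA: "\<iota> k \<in> A"
    using k(1) by (simp add: A_def)
  have "R (reduced \<iota> e D) (\<iota> k) = proportional_egalitarian (reduced \<iota> e D) (\<iota> k)"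
  proof (cases "\<iota> k \<in> K")
    case True
    then show ?thesis
      unfolding red singleton_problem_share[OF P MM R(1,2,4,5) True]
      by (subst proportional_egalitarian_singleton_problem[OF P kA]) (auto simp: K_def)
  next
    case False
    then show ?thesis
      unfolding red using single_visit_unvisited[OF P _ kA False] R(2) dummy_proportional_egalitarian
      by metis
  qed
  then have sums: "(\<Sum>j\<in>?Q. R D j) = (\<Sum>j\<in>?Q. proportional_egalitarian D j)"
    using proportional_egalitarian_consistent[OF D0 \<iota> e k(1)] k
      R(5)[unfolded consortia_consistency_def, rule_format, OF D0 e k(1)] by simp
  let ?V = "visited_museums D a \<inter> ?Q"
  have finQ: "finite ?Q" "?Q \<subseteq> museums D"
    using consortium_subset[OF D Q(1)] by auto
  \<comment> \<open>Proved for an arbitrary \<open>f\<close>, to be applied both to \<open>R\<close>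
    and to the explicit rule.\<close>
  have "(\<Sum>j\<in>?Q. f D j) = real (card ?V) * f D i"
    if f: "dummy MM NN f" "symmetry_within_consortia MM NN f" for f
  proof -
    have "(\<Sum>j\<in>?Q. f D j) = (\<Sum>j\<in>?V. f D j)"
      using single_holder_unvisited[OF D h f(1)] finQ by (intro sum.mono_neutral_right) auto
    also have "\<dots> = (\<Sum>j\<in>?V. f D i)"
      using consortium_of_eq[OF D Q(1)] True
      by (intro sum.cong refl single_holder_symmetric[OF D h _ f(2)]) auto
    finally show ?thesis by simp
  qed
  from this[OF R(2,3)] this[OF dummy_proportional_egalitarian symmetry_proportional_egalitarian]
  have "real (card ?V) * R D i = real (card ?V) * proportional_egalitarian D i"
    using sums by linarith
  moreover have "card ?V \<noteq> 0"
    using True Q(2) finQ(1) by auto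
  ultimately show ?thesis
    by simp
next
  case False
  then show ?thesis
    using single_holder_unvisited[OF D h _ i False] R(2) dummy_proportional_egalitarian by metis
qed

section \<open>Reduction to a single holder\<close>

text \<open>Entries of removed holders are set to 0, the default that \<open>problems\<close>
  prescribes. The restriction is then again a problem, and recombining pieces gives equal
  records.\<close>

definition restrict_holders :: "('m, 'h) problem \<Rightarrow> 'h set \<Rightarrow> ('m, 'h) problem" where
  "restrict_holders D H = D\<lparr>holders := \<lambda>\<sigma>. holders D \<sigma> \<inter> H,
     visits := \<lambda>\<sigma> i a. if a \<in> H then visits D \<sigma> i a else 0\<rparr>"

lemma restrict_holders_simps [simp]:
  "museums (restrict_holders D H) = museums D"
  "consortia (restrict_holders D H) = consortia D"
  "holders (restrict_holders D H) \<sigma> = holders D \<sigma> \<inter> H"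
  "price (restrict_holders D H) = price D"
  "visits (restrict_holders D H) \<sigma> i a = (if a \<in> H then visits D \<sigma> i a else 0)"
  "passes (restrict_holders D H) = passes D"
  "rows (restrict_holders D H) = rows D"
  by (auto simp: restrict_holders_def passes_def rows_def fun_eq_iff split: pass.splits)

lemma restrict_holders_in_problems:
  assumes D: "D \<in> problems MM NN"
  shows "restrict_holders D H \<in> problems MM NN"
proof -
  have dj: "disjoint_family_on (\<lambda>\<sigma>. holders D \<sigma> \<inter> H) (passes D)"
    using problemD(2)[OF D] unfolding disjoint_family_on_def by blast
  have zero: "\<forall>\<sigma> i a. \<sigma> \<notin> passes D \<or> i \<notin> rows D \<sigma> \<or> a \<notin> holders D \<sigma> \<inter> H \<longrightarrow>
      (if a \<in> H then visits D \<sigma> i a else 0) = 0"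
    using problemD(10)[OF D] by auto
  show ?thesis
    unfolding problems_def mem_Collect_eq restrict_holders_simps
    by (intro conjI dj zero)
      (use problem_museums(1-4)[OF D] problemD(1,3-9)[OF D] in \<open>simp_all add: finite_subset\<close>, blast?)
qed

lemma combine_restrict_holders:
  assumes D: "D \<in> problems MM NN" and "H1 \<inter> H2 = {}"
  shows "combine (restrict_holders D H1) (restrict_holders D H2) = restrict_holders D (H1 \<union> H2)"
  using assms(2) problemD(10)[OF D]
  by (intro problem.equality) (auto simp: combine_def fun_eq_iff Int_Un_distrib)

lemma restrict_holders_all:
  assumes D: "D \<in> problems MM NN"
  shows "restrict_holders D (\<Union>\<sigma>\<in>passes D. holders D \<sigma>) = D"
proof -
  let ?H = "\<Union>\<sigma>\<in>passes D. holders D \<sigma>"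
  have "holders D \<sigma> \<inter> ?H = holders D \<sigma>" for \<sigma>
    using problem_holders(3)[OF D] by blast
  moreover have "(if a \<in> ?H then visits D \<sigma> i a else 0) = visits D \<sigma> i a" for \<sigma> i a
    using problemD(10)[OF D] by auto
  ultimately show ?thesis
    unfolding restrict_holders_def by simp
qed

text \<open>Induction on a finite set of holders to which the problem is restricted: each step
  splits off one holder, and both functions are additive under this.\<close>

lemma eq_proportional_egalitarian_if_single_holders:
  assumes D: "D \<in> problems MM NN" and R: "composition MM NN R" "dummy MM NN R"
    and single: "\<And>D \<sigma> a i. D \<in> problems MM NN \<Longrightarrow> holders D = (\<lambda>_. {})(\<sigma> := {a}) \<Longrightarrow>
      i \<in> museums D \<Longrightarrow> R D i = proportional_egalitarian D i"
    and i: "i \<in> museums D"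
  shows "R D i = proportional_egalitarian D i"
proof -
  \<comment> \<open>Without holders every museum is a dummy for both functions. This covers the
    empty set and those elements of \<open>H\<close> that hold no pass.\<close>
  have no_holder: "R E i = proportional_egalitarian E i"
    if "E \<in> problems MM NN" "i \<in> museums E" "\<And>\<sigma>. holders E \<sigma> = {}" for E
    using that R(2) dummy_proportional_egalitarian[of MM NN] unfolding dummy_def by simp
  have "R (restrict_holders D H) i = proportional_egalitarian (restrict_holders D H) i"
    if "finite H" for H
    using that
  proof (induction H)
    case empty
    then show ?case
      using no_holder[OF restrict_holders_in_problems[OF D]] i by simp
  next
    case (insert a H)
    let ?D1 = "restrict_holders D {a}" and ?D2 = "restrict_holders D H"
    have P: "?D1 \<in> problems MM NN" "?D2 \<in> problems MM NN"
      using restrict_holders_in_problems[OF D] by auto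
    have disj: "(\<Union>\<sigma>\<in>passes ?D1. holders ?D1 \<sigma>) \<inter> (\<Union>\<sigma>\<in>passes ?D2. holders ?D2 \<sigma>) = {}"
      using insert.hyps(2) by auto
    have C: "combine ?D1 ?D2 = restrict_holders D (insert a H)"
      using combine_restrict_holders[OF D, of "{a}" H] insert.hyps(2) by simp
    have one: "R ?D1 i = proportional_egalitarian ?D1 i"
    \<comment> \<open>The induction runs over arbitrary finite sets, so \<open>a\<close> need not be
      a holder of \<open>D\<close>.\<close>
    proof (cases "\<exists>\<sigma>. a \<in> holders D \<sigma>")
      case True
      then obtain \<sigma> where \<sigma>: "a \<in> holders D \<sigma>" by blast
      have "holders ?D1 = (\<lambda>_. {})(\<sigma> := {a})"
      proof
        fix \<tau>
        show "holders ?D1 \<tau> = ((\<lambda>_. {})(\<sigma> := {a})) \<tau>"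
          using \<sigma> holders_unique[OF D \<sigma>, of \<tau>] by (cases "\<tau> = \<sigma>") auto
      qed
      then show ?thesis
        using single[OF P(1)] i by simp
    next
      case False
      then show ?thesis
        using no_holder[OF P(1)] i by auto
    qed
    have "R (combine ?D1 ?D2) i = R ?D1 i + R ?D2 i"
      using R(1)[unfolded composition_def, rule_format, OF P] disj i by simp
    then show ?case
      using proportional_egalitarian_combine[OF P _ _ _ disj] one insert.IH unfolding C by simp
  qed
  moreover have "finite (\<Union>\<sigma>\<in>passes D. holders D \<sigma>)"
    using problem_museums[OF D] problem_holders(1)[OF D] by (auto simp: passes_def)
  ultimately show ?thesis
    using restrict_holders_all[OF D] by metis
qed

section \<open>The equivalence\<close>

text \<open>\<open>R\<close> is known to agree with the explicit rule at museums of problems in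
  \<open>problems MM NN\<close> only. Transferring an axiom therefore requires that the combined and
  reduced problems belong to this set and that the museums in question belong to them.\<close>

lemma axioms_proportional_egalitarian:
  assumes "inj_on \<iota> {1..}" and "\<iota> ` {1..} \<subseteq> MM"
    and eq: "\<forall>D\<in>problems MM NN. \<forall>i\<in>museums D. R D i = proportional_egalitarian D i"
  shows "composition MM NN R" "dummy MM NN R" "symmetry_within_consortia MM NN R"
    "splitting_proofness MM NN R" "consortia_consistency MM NN \<iota> R"
proof -
  show "composition MM NN R"
    unfolding composition_def
  proof (intro ballI impI)
    fix D1 D2 :: "('a, 'b) problem" and i
    assume D: "D1 \<in> problems MM NN" "D2 \<in> problems MM NN"
      and *: "museums D1 = museums D2 \<and> consortia D1 = consortia D2 \<and> price D1 = price D2 \<and>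
        (\<Union>\<sigma>\<in>passes D1. holders D1 \<sigma>) \<inter> (\<Union>\<sigma>\<in>passes D2. holders D2 \<sigma>) = {}"
      and i: "i \<in> museums D1"
    have "combine D1 D2 \<in> problems MM NN" "museums (combine D1 D2) = museums D1"
      using combine_in_problems[OF D] * by (auto simp: combine_def)
    then show "R (combine D1 D2) i = R D1 i + R D2 i"
      using proportional_egalitarian_combine[OF D] * i D eq by simp
  qed
  show "dummy MM NN R"
    using dummy_proportional_egalitarian[of MM NN] eq unfolding dummy_def by simp
  show "symmetry_within_consortia MM NN R"
    unfolding symmetry_within_consortia_def
  proof (intro ballI impI, elim conjE)
    fix D :: "('a, 'b) problem" and i j
    assume *: "D \<in> problems MM NN" "i \<in> museums D" "j \<in> museums D"
      and "consortium_of D i = consortium_of D j"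
        "\<forall>a\<in>holders D General. visits D General i a = visits D General j a"
        "\<forall>a\<in>holders D (Consortium (consortium_of D i)).
           visits D (Consortium (consortium_of D i)) i a =
           visits D (Consortium (consortium_of D j)) j a"
        "price D (Individual i) * real (card (holders D (Individual i))) =
        price D (Individual j) * real (card (holders D (Individual j)))"
    then have "proportional_egalitarian D i = proportional_egalitarian D j"
      by (intro proportional_egalitarian_symmetry)
    then show "R D i = R D j"
      using eq * by simp
  qed
  have sum_eq: "(\<Sum>j\<in>Q. R D j) = (\<Sum>j\<in>Q. proportional_egalitarian D j)"
    if "D \<in> problems MM NN" "Q \<in> consortia D" for D Q
    using consortium_subset(1)[OF that] eq that(1) by (intro sum.cong) auto
  show "splitting_proofness MM NN R"
    unfolding splitting_proofness_def
  proof (intro ballI allI impI)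
    fix D D' :: "('a, 'b) problem" and Q t \<phi> Q'
    assume D: "D \<in> problems MM NN" "D' \<in> problems MM NN" and sp: "split_of MM D Q t \<phi> D'"
      and Q': "Q' \<in> consortia D - {Q}"
    have "consortia D' = (consortia D - {Q}) \<union> (\<lambda>l. \<phi> l ` Q) ` {1..t}"
      using sp unfolding split_of_def by (elim conjE)
    then have "Q' \<in> consortia D'"
      using Q' by blast
    then have "(\<Sum>j\<in>Q'. R D' j) = (\<Sum>j\<in>Q'. proportional_egalitarian D' j)"
      by (rule sum_eq[OF D(2)])
    moreover have "(\<Sum>j\<in>Q'. R D j) = (\<Sum>j\<in>Q'. proportional_egalitarian D j)"
      using sum_eq[OF D(1)] Q' by simp
    ultimately show "(\<Sum>j\<in>Q'. R D j) = (\<Sum>j\<in>Q'. R D' j)"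
      using proportional_egalitarian_split[OF D sp Q'] by simp
  qed
  show "consortia_consistency MM NN \<iota> R"
    unfolding consortia_consistency_def
  proof (intro ballI allI impI)
    fix D :: "('a, 'b) problem" and e k
    assume D: "D \<in> problems0 MM NN" and e: "bij_betw e {1..card (consortia D)} (consortia D)"
      and k: "k \<in> {1..card (consortia D)}"
    have "D \<in> problems MM NN" "e k \<in> consortia D"
      using D e k by (auto simp: problems0_def bij_betw_def)
    then have "(\<Sum>i\<in>e k. R D i) = (\<Sum>i\<in>e k. proportional_egalitarian D i)"
      by (rule sum_eq)
    moreover have "\<iota> k \<in> museums (reduced \<iota> e D)"
      using k by (simp add: reduced_def Let_def)
    ultimately show "(\<Sum>i\<in>e k. R D i) = R (reduced \<iota> e D) (\<iota> k)"
      using proportional_egalitarian_consistent[OF D assms(1,2) e k]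
        reduced_in_problems[OF D assms(1,2) e] eq by simp
  qed
qed

theorem theorem3:
  fixes MM :: "'m set" and NN :: "'h set" and \<iota> :: "nat \<Rightarrow> 'm"
    and R :: "('m, 'h) problem \<Rightarrow> 'm \<Rightarrow> real"
  assumes "infinite MM" and "inj_on \<iota> {1..}" and "\<iota> ` {1..} \<subseteq> MM" and "infinite NN"
    and "is_rule MM NN R"
  shows "composition MM NN R \<and> dummy MM NN R \<and> symmetry_within_consortia MM NN R \<and>
         splitting_proofness MM NN R \<and> consortia_consistency MM NN \<iota> R \<longleftrightarrow>
         (\<forall>D\<in>problems MM NN. \<forall>i\<in>museums D. R D i = proportional_egalitarian D i)"
proof
  assume *: "composition MM NN R \<and> dummy MM NN R \<and> symmetry_within_consortia MM NN R \<and>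
         splitting_proofness MM NN R \<and> consortia_consistency MM NN \<iota> R"
  have single: "R D i = proportional_egalitarian D i"
    if "D \<in> problems MM NN" "holders D = (\<lambda>_. {})(\<sigma> := {a})" "i \<in> museums D" for D \<sigma> a i
  proof (cases \<sigma>)
    case (Individual j)
    then show ?thesis
      using individual_holder_share[OF that(1) _ assms(5) _ that(3)] that(2) * by blast
  next
    case General
    then show ?thesis
      using general_holder_share[OF that(1) _ assms(1-3,5) _ _ _ _ that(3)] that(2) * by blast
  next
    case (Consortium Q)
    then show ?thesis
      using consortium_holder_share[OF that(1) _ assms(5) _ _ that(3)] that(2) * by blast
  qed
  show "\<forall>D\<in>problems MM NN. \<forall>i\<in>museums D. R D i = proportional_egalitarian D i"
    using eq_proportional_egalitarian_if_single_holders[of _ MM NN R] single * by blast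
next
  assume "\<forall>D\<in>problems MM NN. \<forall>i\<in>museums D. R D i = proportional_egalitarian D i"
  then show "composition MM NN R \<and> dummy MM NN R \<and> symmetry_within_consortia MM NN R \<and>
         splitting_proofness MM NN R \<and> consortia_consistency MM NN \<iota> R"
    using axioms_proportional_egalitarian[OF assms(2,3)] by blast
qed

end
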